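(* Let $n \ge 3$ and let $P = \{p_1,\dots,p_{n-1}\}$ be a set of $n-1$ distinct primes such that $\sum_{i=1}^{n-1} \frac{1}{p_i} \le 1$. Then there exist infinitely many maximally non-normal rectangular simplices of the form $\Delta(p_1,\dots,p_{n-1},p_n)$ with $p_n \notin P$ prime. Furthermore, for every $N \in \mathbb{Z}_+$ there exists an algorithm (namely the procedure described in the context, with input $P$ and $N$) that outputs $N$ such simplices in finite time.
   Context: $\mathbb{Z}_+$ is the set of positive integers. For $\lambda=(\lambda_1,\dots,\lambda_n)\in\mathbb{Z}_+^n$, the rectangular simplex $\Delta(\lambda) \subset \mathbb{R}^n$ is the convex hull of $\{0,\lambda_1 e_1,\dots,\lambda_n e_n\}$. A lattice polytope $Q \subset \mathbb{R}^n$ is normal if for every integer $k \ge 1$ every $x \in kQ \cap \mathbb{Z}^n$ is a sum of $k$ points of $Q\cap\mathbb{Z}^n$. The normality index is $\mu_{norm}(Q) = \min\{k_0 \in \mathbb{Z}_+ : kQ \text{ is normal for all } k \ge k_0\}$. The rectangular simplex $\Delta(\lambda)$ with $\lambda \in \mathbb{Z}_+^n$ is maximally non-normal if $\mu_{norm}(\Delta(\lambda)) = n-1$. Procedure (input: $P$ and $N$): let $L = \prod_{q\in P} q$; for each $q \in P$ let $\alpha_q$ be the inverse of $L/q$ modulo $q$; let $p$ be the smallest non-negative integer with $p \equiv \alpha_q \pmod q$ for all $q\in P$ (Chinese Remainder Theorem). Start with the empty list $P'$. While $P'$ has fewer than $N$ elements: if $p$ is prime, append $p$ to $P'$; then replace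 $p$ by $p+L$. Return $P'$. Each $p\in P'$ represents the simplex $\Delta(p_1,\dots,p_{n-1},p)$. *)

theory Defs
  imports
    "HOL-Analysis.Analysis"
    "HOL-Number_Theory.Number_Theory"
    "HOL-Number_Theory.Modular_Inverse"
    "HOL-Library.While_Combinator"
begin

definition rect_simplex :: "('n::finite \<Rightarrow> nat) \<Rightarrow> (real ^ 'n) set" where
  "rect_simplex a = convex hull (insert 0 (range (\<lambda>i. real (a i) *\<^sub>R axis i 1)))"

definition int_lattice :: "(real ^ 'n::finite) set" where
  "int_lattice = {x. \<forall>i. x $ i \<in> \<int>}"

definition lattice_polytope :: "(real ^ 'n::finite) set \<Rightarrow> bool" where
  "lattice_polytope Q \<longleftrightarrow> (\<exists>V. finite V \<and> V \<subseteq> int_lattice \<and> Q = convex hull V)"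

definition dilate :: "nat \<Rightarrow> (real ^ 'n::finite) set \<Rightarrow> (real ^ 'n) set" where
  "dilate k Q = (\<lambda>x. real k *\<^sub>R x) ` Q"

definition normal_polytope :: "(real ^ 'n::finite) set \<Rightarrow> bool" where
  "normal_polytope Q \<longleftrightarrow> lattice_polytope Q \<and>
     (\<forall>k\<ge>1. \<forall>x \<in> dilate k Q \<inter> int_lattice.
        \<exists>y :: nat \<Rightarrow> real ^ 'n. (\<forall>j<k. y j \<in> Q \<inter> int_lattice) \<and> x = (\<Sum>j<k. y j))"

definition normality_index :: "(real ^ 'n::finite) set \<Rightarrow> nat" where
  "normality_index Q = (LEAST k0. k0 \<ge> 1 \<and> (\<forall>k\<ge>k0. normal_polytope (dilate k Q)))"

definition maximally_non_normal :: "('n::finite \<Rightarrow> nat) \<Rightarrow> bool" where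
  "maximally_non_normal a \<longleftrightarrow>
     (\<forall>i. a i \<ge> 1) \<and> normality_index (rect_simplex a) = CARD('n) - 1"

definition inverse_residue :: "nat set \<Rightarrow> nat \<Rightarrow> nat" where
  "inverse_residue P q = nat (modular_inverse (int q) (int (\<Prod>P div q)))"

definition crt_start :: "nat set \<Rightarrow> nat" where
  "crt_start P = (LEAST x. \<forall>q\<in>P. [x = inverse_residue P q] (mod q))"

text \<open>
  The loop state is the pair of the current candidate and the list built so far.
  The result is \<open>Some\<close> of the returned list if the loop terminates, and \<open>None\<close> otherwise.
\<close>

definition simplex_procedure :: "nat set \<Rightarrow> nat \<Rightarrow> nat list option" where
  "simplex_procedure P N =
     map_option snd
       (while_option
          (\<lambda>(x, ps). length ps < N)
          (\<lambda>(x, ps). (x + \<Prod>P, if prime x then ps @ [x] else ps))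
          (crt_start P, []))"

text \<open>
  For a finite set of primes the start value is well defined, and the search for it is bounded.
\<close>

lemma crt_start_works:
  assumes "finite P" "\<forall>q\<in>P. prime q"
  shows "\<forall>q\<in>P. [crt_start P = inverse_residue P q] (mod q)" "crt_start P < \<Prod>P"
proof -
  have "\<exists>!x. x < (\<Prod>q\<in>P. q) \<and> (\<forall>q\<in>P. [x = inverse_residue P q] (mod q))"
    using assms by (intro chinese_remainder_unique_nat)
      (auto simp: primes_coprime prime_gt_0_nat)
  then obtain x where x: "x < \<Prod>P" "\<forall>q\<in>P. [x = inverse_residue P q] (mod q)"
    by auto
  show "\<forall>q\<in>P. [crt_start P = inverse_residue P q] (mod q)"
    unfolding crt_start_def by (rule LeastI[of _ x]) (rule x(2))
  have "crt_start P \<le> x"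
    unfolding crt_start_def by (rule Least_le) (rule x(2))
  with x(1) show "crt_start P < \<Prod>P" by simp
qed

lemma inverse_residue_works:
  assumes "finite P" "\<forall>q\<in>P. prime q" "q \<in> P"
  shows "[(\<Prod>P div q) * inverse_residue P q = 1] (mod q)" "inverse_residue P q < q"
proof -
  have q: "q > 0" using assms by (auto simp: prime_gt_0_nat)
  have "\<Prod>P = q * \<Prod>(P - {q})" using assms by (intro prod.remove)
  then have eq: "\<Prod>P div q = \<Prod>(P - {q})" using q by simp
  have "coprime (\<Prod>(P - {q})) q"
    using assms by (intro prod_coprime_left) (auto simp: primes_coprime)
  then have cop: "coprime (int (\<Prod>P div q)) (int q)" 
    unfolding eq by (simp add: coprime_int_iff del: of_nat_prod)
  have nn: "modular_inverse (int q) (int (\<Prod>P div q)) \<ge> 0"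
    using q by (simp add: modular_inverse_int_nonneg)
  have "[int (\<Prod>P div q) * modular_inverse (int q) (int (\<Prod>P div q)) = 1] (mod int q)"
    by (rule cong_modular_inverse1[OF cop])
  then have "[int ((\<Prod>P div q) * inverse_residue P q) = int 1] (mod int q)"
    using nn by (simp add: inverse_residue_def del: of_nat_prod)
  then show "[(\<Prod>P div q) * inverse_residue P q = 1] (mod q)"
    using cong_int_iff by blast
  have "modular_inverse (int q) (int (\<Prod>P div q)) < int q"
    using q by (simp add: modular_inverse_int_less)
  then show "inverse_residue P q < q"
    using nn by (simp add: inverse_residue_def)
qed

end

(*
  Let L be the product of P and s the sum of the L / r for r in P. The residue class searched by the
  procedure is the one with q * s congruent to 1 modulo L, say q * s = 1 + t * L. For such q the
  lattice point with coordinates r - 1 (r in P) and t has weight sum x_i / lambda_i equal to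
  (n - 1) - 1 / (q * L), the largest value below n - 1 that weights of lattice points can take, and
  this prevents the dilation by n - 2 from being normal; that s <= L is what makes t < q. Dilations
  by k >= n - 1 are always normal, because a lattice point of weight at most h, h >= n, stays a
  lattice point of the orthant after removing a vertex, or a whole coordinate, of weight at most 1
  that leaves weight at most h - 1.

  That the residue class contains infinitely many primes is Dirichlet's theorem, which follows as
  in the work of Mertens and Shapiro: sum chi(n) Lambda(n) / n over n <= N stays bounded if
  L(1,chi) is nonzero and is -ln N + O(1) otherwise; the second case is excluded by the 3-4-1
  inequality when chi^2 is nonprincipal, and by Monsky's Lambert series argument when chi is real.
*)

theory Submission
  imports
    Defs
    "HOL-Computational_Algebra.Squarefree"
    "HOL-Library.Real_Mod"
    "HOL-Real_Asymp.Real_Asymp"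
begin

section \<open>The estimates of Chebyshev and Mertens\<close>

text \<open>All weights of lattice points are multiples of 1 / (q * L). If two summands have weight
  at most an integer k each and together miss 2 * k by a single unit, the deficiency cannot be
  shared, so one of the two weights is k exactly; pairwise coprimality of the parameters then forces
  that summand to be a sum of vertices. This is why the residue class aims at a deficiency of
  exactly 1 / (q * L). In Dirichlet's theorem the danger is a character sum behaving like -ln N,
  which could cancel the ln N of the principal character. Once this is excluded, orthogonality shows
  that the sum of Lambda(n) / n over the residue class is unbounded, whereas finitely many primes
  together with all higher prime powers would contribute only a bounded amount.\<close>

lemma sum_divisors_swap:
  fixes F :: "nat \<Rightarrow> nat \<Rightarrow> 'a::comm_monoid_add"
  shows "(\<Sum>n=1..N. \<Sum>d | d dvd n. F d (n div d)) = (\<Sum>d=1..N. \<Sum>m=1..N div d. F d m)"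
proof -
  have "(\<Sum>n=1..N. \<Sum>d | d dvd n. F d (n div d))
      = (\<Sum>(n,d)\<in>(SIGMA n:{1..N}. {d. d dvd n}). F d (n div d))"
    by (rule sum.Sigma) auto
  also have "\<dots> = (\<Sum>(d,m)\<in>(SIGMA d:{1..N}. {1..N div d}). F d m)"
  proof (rule sum.reindex_bij_witness[of _ "\<lambda>(d,m). (d * m, d)" "\<lambda>(n,d). (d, n div d)"])
    fix a assume a: "a \<in> (SIGMA n:{1..N}. {d. d dvd n})"
    obtain n d where nd: "a = (n, d)" by force
    from a nd have 1: "n \<ge> 1" "n \<le> N" "d dvd n" by auto
    then obtain m where m: "n = d * m" by auto
    with 1 have "d \<ge> 1" "m \<ge> 1" by auto
    with 1 m show "(case (case a of (n,d) \<Rightarrow> (d, n div d)) of (d,m) \<Rightarrow> (d * m, d)) = a"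
      "(case a of (n,d) \<Rightarrow> (d, n div d)) \<in> (SIGMA d:{1..N}. {1..N div d})"
      "(case (case a of (n,d) \<Rightarrow> (d, n div d)) of (d,m) \<Rightarrow> F d m) = (case a of (n,d) \<Rightarrow> F d (n div d))"
      by (auto simp: nd less_eq_div_iff_mult_less_eq mult.commute intro: order.trans[of d "d * m"])
  next
    fix b assume b: "b \<in> (SIGMA d:{1..N}. {1..N div d})"
    obtain d m where dm: "b = (d, m)" by force
    from b dm have 1: "d \<ge> 1" "d \<le> N" "m \<ge> 1" "m \<le> N div d" by auto
    then have "d * m \<le> N" by (simp add: less_eq_div_iff_mult_less_eq mult.commute)
    with 1 show "(case (case b of (d,m) \<Rightarrow> (d * m, d)) of (n,d) \<Rightarrow> (d, n div d)) = b"
      "(case b of (d,m) \<Rightarrow> (d * m, d)) \<in> (SIGMA n:{1..N}. {d. d dvd n})"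
      by (auto simp: dm)
  qed
  also have "\<dots> = (\<Sum>d=1..N. \<Sum>m=1..N div d. F d m)"
    by (rule sum.Sigma[symmetric]) auto
  finally show ?thesis .
qed

section \<open>The Moebius function and its divisor sums\<close>

definition moebius_mu :: "nat \<Rightarrow> real" where
  "moebius_mu n = (if squarefree n then (- 1) ^ card (prime_factors n) else 0)"

lemma abs_moebius_mu_le: "\<bar>moebius_mu n\<bar> \<le> 1"
  by (simp add: moebius_mu_def power_abs)

lemma moebius_mu_prime_mult:
  assumes "prime p" "\<not> p dvd n"
  shows "moebius_mu (p * n) = - moebius_mu n"
proof -
  from assms have n: "n \<noteq> 0" by (intro notI) auto
  from assms have cop: "coprime p n" by (simp add: prime_imp_coprime)
  have sq: "squarefree (p * n) \<longleftrightarrow> squarefree n"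
    using assms cop squarefree_mult_coprime[of p n] squarefree_multD(2)[of p n] squarefree_prime[of p] by blast
  have "prime_factors (p * n) = insert p (prime_factors n)"
    using assms n by (auto simp: prime_factors_product prime_prime_factors)
  moreover have "p \<notin> prime_factors n" using assms by auto
  ultimately have "card (prime_factors (p * n)) = Suc (card (prime_factors n))" by simp
  with sq show ?thesis by (simp add: moebius_mu_def)
qed

text \<open>For a prime p dividing n, multiplication by p pairs the squarefree divisors not
  divisible by p with those divisible by p, and the two members of a pair cancel.\<close>

lemma sum_moebius_mu_divisors:
  assumes "n > 0"
  shows "(\<Sum>d | d dvd n. moebius_mu d) = (if n = 1 then 1 else 0)"
proof (cases "n = 1")
  case True
  then show ?thesis by (simp add: moebius_mu_def)
next
  case False
  then obtain p where p: "prime p" "p dvd n" using prime_factor_nat by blast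
  let ?D = "{d. d dvd n \<and> squarefree d}"
  have fin: "finite {d. d dvd n}" using assms by simp
  have "(\<Sum>d | d dvd n. moebius_mu d) = sum moebius_mu ?D"
    using fin by (intro sum.mono_neutral_right) (auto simp: moebius_mu_def)
  also have "\<dots> = sum moebius_mu {d\<in>?D. p dvd d} + sum moebius_mu {d\<in>?D. \<not> p dvd d}"
    using fin by (subst sum.union_disjoint[symmetric]) (auto intro!: sum.cong)
  also have "sum moebius_mu {d\<in>?D. p dvd d} = (\<Sum>d\<in>{d\<in>?D. \<not> p dvd d}. - moebius_mu d)"
  proof (rule sum.reindex_bij_witness[of _ "\<lambda>d. p * d" "\<lambda>d. d div p"])
    fix a assume a: "a \<in> {d\<in>?D. p dvd d}"
    then obtain b where b: "a = p * b" by auto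
    have "p > 0" using p prime_gt_0_nat by blast
    have nb: "\<not> p dvd b"
    proof
      assume "p dvd b"
      then have "p ^ 2 dvd a" by (auto simp: b power2_eq_square)
      with a have "is_unit p" unfolding squarefree_def by auto
      with p show False by auto
    qed
    show "p * (a div p) = a" using b \<open>p > 0\<close> by simp
    show "a div p \<in> {d\<in>?D. \<not> p dvd d}"
      using a b nb \<open>p > 0\<close> squarefree_multD(2)[of p b] by (auto intro: dvd_mult_right)
    show "- moebius_mu (a div p) = moebius_mu a"
      using b \<open>p > 0\<close> moebius_mu_prime_mult[OF p(1) nb] by simp
  next
    fix a assume a: "a \<in> {d\<in>?D. \<not> p dvd d}"
    have "p > 0" using p prime_gt_0_nat by blast
    then show "p * a div p = a" by simp
    from a p have cop: "coprime p a" by (simp add: prime_imp_coprime)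
    with a p show "p * a \<in> {d\<in>?D. p dvd d}"
      by (auto intro: divides_mult squarefree_mult_coprime squarefree_prime)
  qed
  finally show ?thesis using False by (simp add: sum_negf)
qed

text \<open>Moebius inversion of the identity that ln is the divisor sum of Lambda gives Lambda(n)
  as the sum of mu(d) ln(n / d). Splitting the logarithm, the part with ln n vanishes: the sum of mu
  is 0 for n > 1, and ln 1 = 0.\<close>

lemma sum_moebius_mu_ln:
  assumes "n > 0"
  shows "(\<Sum>d | d dvd n. moebius_mu d * ln (real d)) = - mangoldt n"
proof -
  have fin: "finite {d. d dvd n}" using assms by simp
  have swap: "e dvd n" "d dvd n div e" if "d dvd n" "e dvd n div d" for d e
    using that assms by (metis dvd_div_iff_mult dvd_mult_right mult.commute dvd_0_left_iff gr_implies_not0)+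
  have "(\<Sum>d | d dvd n. moebius_mu d * ln (real (n div d)))
      = (\<Sum>d | d dvd n. \<Sum>e | e dvd n div d. moebius_mu d * mangoldt e)"
  proof (rule sum.cong)
    fix d assume d: "d \<in> {d. d dvd n}"
    with assms have "n div d > 0" by (auto simp: dvd_div_eq_0_iff)
    then show "moebius_mu d * ln (real (n div d)) = (\<Sum>e | e dvd n div d. moebius_mu d * mangoldt e)"
      using mangoldt_sum[of "n div d", where 'a = real] by (simp flip: sum_distrib_left)
  qed simp
  also have "\<dots> = (\<Sum>(d,e)\<in>(SIGMA d:{d. d dvd n}. {e. e dvd n div d}). moebius_mu d * mangoldt e)"
    using assms by (intro sum.Sigma) (auto simp: dvd_div_eq_0_iff)
  also have "\<dots> = (\<Sum>(e,d)\<in>(SIGMA e:{e. e dvd n}. {d. d dvd n div e}). moebius_mu d * mangoldt e)"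
    by (intro sum.reindex_bij_witness[of _ "\<lambda>(x,y). (y,x)" "\<lambda>(x,y). (y,x)"]) (auto intro: swap)
  also have "\<dots> = (\<Sum>e | e dvd n. \<Sum>d | d dvd n div e. moebius_mu d * mangoldt e)"
    using assms by (intro sum.Sigma[symmetric]) (auto simp: dvd_div_eq_0_iff)
  also have "\<dots> = (\<Sum>e | e dvd n. if e = n then mangoldt n else 0)"
  proof (rule sum.cong)
    fix e assume e: "e \<in> {e. e dvd n}"
    with assms have pos: "n div e > 0" by (auto simp: dvd_div_eq_0_iff)
    have "(\<Sum>d | d dvd n div e. moebius_mu d * mangoldt e) = (if n div e = 1 then 1 else 0) * mangoldt e"
      by (simp only: sum_distrib_right[symmetric] sum_moebius_mu_divisors[OF pos])
    also have "n div e = 1 \<longleftrightarrow> e = n" using e assms by auto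
    finally show "(\<Sum>d | d dvd n div e. moebius_mu d * mangoldt e) = (if e = n then mangoldt n else 0)" by simp
  qed simp
  also have "\<dots> = mangoldt n" using assms by (simp add: sum.delta)
  finally have A: "(\<Sum>d | d dvd n. moebius_mu d * ln (real (n div d))) = mangoldt n" .
  have "(\<Sum>d | d dvd n. moebius_mu d * ln (real (n div d)))
      = (\<Sum>d | d dvd n. moebius_mu d * ln (real n) - moebius_mu d * ln (real d))"
  proof (rule sum.cong)
    fix d assume d: "d \<in> {d. d dvd n}"
    then obtain m where m: "n = d * m" by auto
    with assms have "d > 0" "m > 0" by auto
    then show "moebius_mu d * ln (real (n div d)) = moebius_mu d * ln (real n) - moebius_mu d * ln (real d)"
      using m by (simp add: ln_mult algebra_simps)
  qed simp
  also have "\<dots> = (\<Sum>d | d dvd n. moebius_mu d) * ln (real n) - (\<Sum>d | d dvd n. moebius_mu d * ln (real d))"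
    by (simp add: sum_subtractf sum_distrib_right)
  also have "(\<Sum>d | d dvd n. moebius_mu d) * ln (real n) = 0"
    using sum_moebius_mu_divisors[OF assms] by simp
  finally show ?thesis using A by simp
qed

section \<open>Chebyshev's bound and Mertens' sum\<close>

definition chebyshev_psi :: "nat \<Rightarrow> real" where
  "chebyshev_psi N = (\<Sum>d=1..N. mangoldt d)"

lemma of_nat_div_le: "real (n div d) \<le> real n / real d"
proof (cases "d = 0")
  case False
  have "real (n div d * d) \<le> real n" by (subst of_nat_le_iff) simp
  with False show ?thesis by (simp add: field_simps)
qed simp

lemma of_nat_le_div_add_one:
  assumes "d > 0"
  shows "real n / real d \<le> real (n div d) + 1"
proof -
  have "n \<le> (n div d + 1) * d"
    using assms by (metis add.commute dividend_less_times_div less_imp_le mult.commute mult_Suc_right plus_1_eq_Suc)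
  then have "real n \<le> real ((n div d + 1) * d)" by (subst of_nat_le_iff)
  with assms show ?thesis by (simp add: field_simps)
qed

lemma ln_fact_sum: "ln (fact N) = (\<Sum>n=1..N. ln (real n))"
  by (induction N) (simp_all add: ln_mult)

text \<open>Each d up to N is counted once for each of its \<open>N div d\<close> multiples up to
  N.\<close>

lemma ln_fact_mangoldt: "ln (fact N) = (\<Sum>d=1..N. mangoldt d * real (N div d))"
proof -
  have "ln (fact N) = (\<Sum>n=1..N. \<Sum>d | d dvd n. mangoldt d :: real)"
    unfolding ln_fact_sum by (rule sum.cong) (auto simp: mangoldt_sum)
  also have "\<dots> = (\<Sum>d=1..N. mangoldt d * real (N div d))"
    by (subst sum_divisors_swap[of "\<lambda>d m. mangoldt d"]) (simp add: mult.commute)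
  finally show ?thesis .
qed

lemma ln_fact_le: "ln (fact N) \<le> real N * ln (real N)"
proof (cases "N = 0")
  case False
  have "(\<Sum>n=1..N. ln (real n)) \<le> (\<Sum>n=1..N. ln (real N))"
    by (intro sum_mono) auto
  then show ?thesis by (simp add: ln_fact_sum)
qed simp

text \<open>A crude Stirling bound: passing from N to N + 1 costs N * (ln(N + 1) - ln N), which is
  at most 1.\<close>

lemma ln_fact_ge: "ln (fact N) \<ge> real N * ln (real N) - real N"
proof (induction N)
  case (Suc N)
  show ?case
  proof (cases "N = 0")
    case False
    have "ln (1 + 1 / real N) \<le> 1 / real N" using False by (intro ln_add_one_self_le_self) auto
    moreover have "1 + 1 / real N = real (Suc N) / real N" using False by (simp add: field_simps)
    ultimately have "ln (real (Suc N)) - ln (real N) \<le> 1 / real N"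
      using False by (simp add: ln_div)
    then have "real N * (ln (real (Suc N)) - ln (real N)) \<le> 1"
      using False by (simp add: field_simps)
    moreover have "ln (fact (Suc N)) = ln (real (Suc N)) + ln (fact N)"
      by (simp add: ln_mult)
    moreover have "real (Suc N) * ln (real (Suc N)) = ln (real (Suc N)) + real N * ln (real (Suc N))"
      by (simp add: algebra_simps)
    ultimately show ?thesis using Suc by (simp add: right_diff_distrib del: fact_Suc)
  qed simp
qed simp

text \<open>Chebyshev's device: the logarithm of the central binomial coefficient is the sum of
  Lambda(d) with coefficients \<open>2 * N div d\<close> - 2 * \<open>N div d\<close>, which are
  nonnegative and equal 1 for N < d \<le> 2 * N. The coefficient itself is at most 4 to the N, and
  ln 4 < 2.\<close>

lemma chebyshev_psi_double: "chebyshev_psi (2 * N) \<le> chebyshev_psi N + 2 * real N"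
proof -
  have "chebyshev_psi (2 * N) - chebyshev_psi N = (\<Sum>d=N+1..2*N. mangoldt d)"
    unfolding chebyshev_psi_def
    using sum.ub_add_nat[of 1 N "mangoldt :: nat \<Rightarrow> real" N] by (simp add: mult_2)
  also have "\<dots> \<le> (\<Sum>d=N+1..2*N. mangoldt d * (real (2 * N div d) - 2 * real (N div d)))"
  proof (rule sum_mono)
    fix d assume d: "d \<in> {N+1..2*N}"
    then have "N div d = 0" "2 * N div d = 1" by (auto intro: div_nat_eqI)
    then show "mangoldt d \<le> mangoldt d * (real (2 * N div d) - 2 * real (N div d))" by simp
  qed
  also have "\<dots> \<le> (\<Sum>d=1..2*N. mangoldt d * (real (2 * N div d) - 2 * real (N div d)))"
  proof (rule sum_mono2)
    fix d assume "d \<in> {1..2*N} - {N+1..2*N}"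
    then have "d > 0" by auto
    then have "2 * (N div d) \<le> 2 * N div d"
      by (metis div_mult2_eq div_times_less_eq_dividend less_eq_div_iff_mult_less_eq mult.assoc mult_le_mono2)
    then have "2 * real (N div d) \<le> real (2 * N div d)"
      by (metis of_nat_le_iff of_nat_mult of_nat_numeral)
    then show "0 \<le> mangoldt d * (real (2 * N div d) - 2 * real (N div d))"
      by (intro mult_nonneg_nonneg mangoldt_nonneg) auto
  qed auto
  also have "\<dots> = ln (fact (2 * N)) - 2 * (\<Sum>d=1..2*N. mangoldt d * real (N div d))"
    by (simp add: ln_fact_mangoldt sum_subtractf sum_distrib_left algebra_simps)
  also have "(\<Sum>d=1..2*N. mangoldt d * real (N div d)) = (\<Sum>d=1..N. mangoldt d * real (N div d))"
    by (rule sum.mono_neutral_right) auto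
  also have "\<dots> = ln (fact N)" by (simp add: ln_fact_mangoldt)
  also have "ln (fact (2 * N)) - 2 * ln (fact N) = ln (real ((2 * N) choose N))"
  proof -
    have "fact N * fact N * ((2 * N) choose N) = (fact (2 * N) :: nat)"
      using binomial_fact_lemma[of N "2 * N"] by (simp add: mult_2)
    then have "real (fact (2 * N)) = fact N * fact N * real ((2 * N) choose N)"
      by (metis of_nat_mult of_nat_fact)
    then have "(fact (2 * N) :: real) = fact N * fact N * real ((2 * N) choose N)" by simp
    then show ?thesis by (simp add: ln_mult)
  qed
  also have "\<dots> \<le> ln (2 ^ (2 * N))"
  proof -
    have "(2 * N) choose N \<le> 2 ^ (2 * N)" by (rule binomial_le_pow2)
    then have "real ((2 * N) choose N) \<le> 2 ^ (2 * N)"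
      by (metis of_nat_le_iff of_nat_numeral of_nat_power)
    then show ?thesis by (subst ln_le_cancel_iff) auto
  qed
  also have "\<dots> = 2 * real N * ln 2" by (simp add: ln_realpow)
  also have "\<dots> \<le> 2 * real N * 1" using ln_2_less_1 by (intro mult_left_mono) auto
  finally show ?thesis by simp
qed

text \<open>Induction by halving. With M = N div 2 the doubling step gives 6 * M, and for odd N the
  extra term is at most ln N \<le> N - 1 = 2 * M; the constant 4 absorbs both.\<close>

lemma chebyshev_psi_le: "chebyshev_psi N \<le> 4 * real N"
proof (induction N rule: less_induct)
  case (less N)
  show ?case
  proof (cases "N = 0")
    case True
    then show ?thesis by (simp add: chebyshev_psi_def)
  next
    case False
    define M where "M = N div 2"
    have IH: "chebyshev_psi M \<le> 4 * real M" using False by (intro less) (auto simp: M_def)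
    have dbl: "chebyshev_psi (2 * M) \<le> 6 * real M" using chebyshev_psi_double[of M] IH by simp
    consider "N = 2 * M" | "N = Suc (2 * M)" unfolding M_def by linarith
    then show ?thesis
    proof cases
      case 1
      then show ?thesis using dbl by simp
    next
      case 2
      have "mangoldt N \<le> ln (real N)" using False by (intro mangoldt_le) auto
      also have "\<dots> \<le> real N - 1" using False by (intro ln_le_minus_one) auto
      finally have "mangoldt N \<le> 2 * real M" using 2 by simp
      moreover have "chebyshev_psi N = chebyshev_psi (2 * M) + mangoldt N"
        by (simp add: 2 chebyshev_psi_def)
      ultimately show ?thesis using dbl 2 by simp
    qed
  qed
qed

lemma mertens_lower:
  assumes "N > 0"
  shows "(\<Sum>d=1..N. mangoldt d / real d) \<ge> ln (real N) - 1"
proof -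
  have "real N * ln (real N) - real N \<le> (\<Sum>d=1..N. mangoldt d * real (N div d))"
    using ln_fact_ge[of N] by (simp add: ln_fact_mangoldt)
  also have "\<dots> \<le> (\<Sum>d=1..N. mangoldt d * (real N / real d))"
    by (intro sum_mono mult_left_mono mangoldt_nonneg of_nat_div_le)
  also have "\<dots> = real N * (\<Sum>d=1..N. mangoldt d / real d)"
    by (simp add: sum_distrib_left algebra_simps)
  finally have "real N * (ln (real N) - 1) \<le> real N * (\<Sum>d=1..N. mangoldt d / real d)"
    by (simp add: algebra_simps)
  then show ?thesis using assms by simp
qed

text \<open>Replacing \<open>N div d\<close> by N / d in the formula for ln N! costs at most
  Lambda(d) for each d, hence \<open>chebyshev_psi N\<close> in total; after division by N this is
  the constant 4.\<close>

lemma mertens_upper: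
  assumes "N > 0"
  shows "(\<Sum>d=1..N. mangoldt d / real d) \<le> ln (real N) + 4"
proof -
  have "real N * (\<Sum>d=1..N. mangoldt d / real d) = (\<Sum>d=1..N. mangoldt d * (real N / real d))"
    by (simp add: sum_distrib_left algebra_simps)
  also have "\<dots> \<le> (\<Sum>d=1..N. mangoldt d * (real (N div d) + 1))"
  proof (intro sum_mono mult_left_mono mangoldt_nonneg)
    fix d assume "d \<in> {1..N}"
    then show "real N / real d \<le> real (N div d) + 1"
      using of_nat_le_div_add_one[of d N] by simp
  qed
  also have "\<dots> = ln (fact N) + chebyshev_psi N"
    by (simp add: ln_fact_mangoldt chebyshev_psi_def sum.distrib distrib_left)
  also have "\<dots> \<le> real N * ln (real N) + 4 * real N"
    by (intro add_mono ln_fact_le chebyshev_psi_le)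
  finally have "real N * (\<Sum>d=1..N. mangoldt d / real d) \<le> real N * (ln (real N) + 4)"
    by (simp add: algebra_simps)
  then show ?thesis using assms by simp
qed

section \<open>Dirichlet characters and nonvanishing at 1\<close>

locale dirichlet_character =
  fixes L :: nat and \<psi> :: "nat \<Rightarrow> complex"
  assumes modulus_pos: "L > 0"
    and mult: "\<psi> (m * n) = \<psi> m * \<psi> n"
    and periodic: "\<psi> (n + L) = \<psi> n"
    and norm_eq_1: "coprime n L \<Longrightarrow> norm (\<psi> n) = 1"
    and eq_zero: "\<not> coprime n L \<Longrightarrow> \<psi> n = 0"
begin

lemma one [simp]: "\<psi> (Suc 0) = 1"
proof -
  have "\<psi> 1 * \<psi> 1 = \<psi> 1" using mult[of 1 1] by simp
  moreover have "\<psi> 1 \<noteq> 0" using norm_eq_1[of 1] by auto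
  ultimately show ?thesis by simp
qed

lemma mod_modulus: "\<psi> (n mod L) = \<psi> n"
proof -
  have "\<psi> (m + k * L) = \<psi> m" for m k
  proof (induction k)
    case (Suc k)
    then show ?case using periodic[of "m + k * L"] by (simp add: ac_simps)
  qed simp
  from this[of "n mod L" "n div L"] show ?thesis by simp
qed

lemma norm_le_1: "norm (\<psi> n) \<le> 1"
  using norm_eq_1[of n] eq_zero[of n] by (cases "coprime n L") auto

lemma div_of_dvd:
  assumes "n > 0" "d dvd n"
  shows "\<psi> n / of_nat n = \<psi> d / of_nat d * (\<psi> (n div d) / of_nat (n div d))"
proof -
  from assms obtain m where m: "n = d * m" by auto
  with assms have "d > 0" by auto
  with m show ?thesis by (simp add: mult)
qed

definition mangoldt_sum :: "nat \<Rightarrow> complex" where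
  "mangoldt_sum N = (\<Sum>n=1..N. \<psi> n * mangoldt n / of_nat n)"

definition harmonic_sum :: "nat \<Rightarrow> complex" where
  "harmonic_sum N = (\<Sum>n=1..N. \<psi> n / of_nat n)"

text \<open>The series converges only conditionally, so its value is taken as the limit of the
  partial sums in the natural order. Convergence is established for nonprincipal characters.\<close>

definition L_one :: complex where
  "L_one = lim harmonic_sum"

end

section \<open>Partial summation for nonprincipal characters\<close>

locale nonprincipal_character = dirichlet_character +
  assumes nonprincipal: "\<exists>m. coprime m L \<and> \<psi> m \<noteq> 1"
begin

text \<open>Multiplication by a unit m with \<open>\<psi> m \<noteq> 1\<close> permutes the
  residues, so the sum equals \<open>\<psi> m\<close> times itself.\<close>

lemma sum_period: "(\<Sum>n<L. \<psi> n) = 0"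
proof -
  obtain m where m: "coprime m L" "\<psi> m \<noteq> 1" using nonprincipal by blast
  let ?f = "\<lambda>n. m * n mod L"
  have inj: "inj_on ?f {..<L}"
  proof (rule inj_onI)
    fix a b assume ab: "a \<in> {..<L}" "b \<in> {..<L}" "?f a = ?f b"
    then have "[m * a = m * b] (mod L)" by (simp add: cong_def)
    then have "[a = b] (mod L)" using m by (simp add: cong_mult_lcancel_nat)
    with ab show "a = b" by (simp add: cong_def)
  qed
  have "?f ` {..<L} \<subseteq> {..<L}" using modulus_pos by auto
  with inj have img: "?f ` {..<L} = {..<L}" by (intro endo_inj_surj) auto
  have "(\<Sum>n<L. \<psi> n) = (\<Sum>n\<in>?f ` {..<L}. \<psi> n)" by (simp add: img)
  also have "\<dots> = (\<Sum>n<L. \<psi> (?f n))" using inj by (subst sum.reindex) (auto simp: o_def)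
  also have "\<dots> = \<psi> m * (\<Sum>n<L. \<psi> n)" by (simp add: mod_modulus mult sum_distrib_left)
  finally have "(1 - \<psi> m) * (\<Sum>n<L. \<psi> n) = 0" by (simp add: algebra_simps)
  with m show ?thesis by simp
qed

lemma norm_partial_sum_le: "norm (\<Sum>n<N. \<psi> n) \<le> real L"
proof (induction N rule: less_induct)
  case (less N)
  show ?case
  proof (cases "N < L")
    case True
    have "norm (\<Sum>n<N. \<psi> n) \<le> (\<Sum>n<N. 1)" by (intro sum_norm_le norm_le_1)
    with True show ?thesis by simp
  next
    case False
    have "(\<Sum>n<L + k. \<psi> n) = (\<Sum>n<L. \<psi> n) + (\<Sum>n<k. \<psi> (L + n))" for k
      by (induction k) (simp_all add: add.assoc)
    from this[of "N - L"] have "(\<Sum>n<N. \<psi> n) = (\<Sum>n<N - L. \<psi> n)"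
      using False periodic by (simp add: sum_period add.commute)
    moreover have "norm (\<Sum>n<N - L. \<psi> n) \<le> real L"
      using False modulus_pos by (intro less) auto
    ultimately show ?thesis by simp
  qed
qed

text \<open>Abel summation. The partial sums of \<open>\<psi>\<close> stay below L and the
  differences of f telescope, so the two boundary terms and the remaining sum add up to L * f N + L
  * f M + L * (f M - f N).\<close>

lemma norm_sum_antimono_le:
  assumes anti: "\<And>n. n \<ge> M \<Longrightarrow> f (Suc n) \<le> f n" and nonneg: "\<And>n. n \<ge> M \<Longrightarrow> 0 \<le> f n"
    and "M \<le> N"
  shows "norm (\<Sum>n\<in>{M..<N}. \<psi> n * of_real (f n)) \<le> 2 * real L * f M"
proof -
  define A where "A k = (\<Sum>n<k. \<psi> n)" for k
  define B where "B k = (\<Sum>n\<in>{M..<k}. A (Suc n) * of_real (f n - f (Suc n)))" for k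
  have A: "norm (A k) \<le> real L" for k unfolding A_def by (rule norm_partial_sum_le)
  have B: "norm (B N) \<le> real L * (f M - f N)" using \<open>M \<le> N\<close>
  proof (induction N rule: dec_induct)
    case (step n)
    have "norm (B (Suc n)) \<le> norm (B n) + norm (A (Suc n)) * \<bar>f n - f (Suc n)\<bar>"
      using step(1) norm_triangle_ineq[of "B n" "A (Suc n) * of_real (f n - f (Suc n))"]
      unfolding norm_mult norm_of_real by (simp add: B_def)
    also have "\<dots> \<le> real L * (f M - f n) + real L * (f n - f (Suc n))"
      using step anti[of n] A[of "Suc n"] by (intro add_mono mult_mono) auto
    finally show ?case by (simp add: algebra_simps)
  qed (simp add: B_def)
  have eq: "(\<Sum>n\<in>{M..<N}. \<psi> n * of_real (f n)) = A N * of_real (f N) - A M * of_real (f M) + B N"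
    using \<open>M \<le> N\<close>
  proof (induction N rule: dec_induct)
    case (step n)
    then show ?case by (simp add: B_def A_def algebra_simps)
  qed (simp add: B_def)
  have "norm (\<Sum>n\<in>{M..<N}. \<psi> n * of_real (f n))
      \<le> norm (A N * of_real (f N)) + norm (A M * of_real (f M)) + norm (B N)"
    unfolding eq by (rule order.trans[OF norm_triangle_ineq add_right_mono[OF norm_triangle_ineq4]])
  also have "\<dots> \<le> real L * f N + real L * f M + real L * (f M - f N)"
    using nonneg[of N] nonneg[of M] \<open>M \<le> N\<close> A B
    by (intro add_mono) (auto simp: norm_mult intro!: mult_right_mono)
  finally show ?thesis by (simp add: algebra_simps)
qed

lemma norm_harmonic_sum_diff_le:
  assumes "M \<le> N"
  shows "norm (harmonic_sum N - harmonic_sum M) \<le> 2 * real L / real (Suc M)"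
proof -
  have "harmonic_sum N - harmonic_sum M = (\<Sum>n\<in>{Suc M..<Suc N}. \<psi> n * of_real (1 / real n))"
    using assms
  proof (induction N rule: dec_induct)
    case (step n)
    then show ?case by (simp add: harmonic_sum_def algebra_simps)
  qed simp
  also have "norm \<dots> \<le> 2 * real L * (1 / real (Suc M))"
    using assms by (intro norm_sum_antimono_le) (auto simp: field_simps)
  finally show ?thesis by simp
qed

text \<open>A bound on the differences with all later partial sums gives the Cauchy property and, in
  the limit, the rate. The rate 1 / M is what keeps the later error terms bounded after summation
  against Lambda.\<close>

lemma norm_harmonic_sum_minus_L_one_le:
  "norm (harmonic_sum M - L_one) \<le> 2 * real L / real (Suc M)"
proof -
  have "Cauchy harmonic_sum"
    unfolding Cauchy_altdef2
  proof (intro allI impI)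
    fix e :: real assume "e > 0"
    then obtain M :: nat where M: "2 * real L / e < real M" using reals_Archimedean2 by blast
    have "dist (harmonic_sum n) (harmonic_sum M) < e" if "n \<ge> M" for n
    proof -
      have "dist (harmonic_sum n) (harmonic_sum M) \<le> 2 * real L / real (Suc M)"
        unfolding dist_norm using that by (rule norm_harmonic_sum_diff_le)
      also have "\<dots> < e" using M \<open>e > 0\<close> by (simp add: field_simps) 
      finally show ?thesis .
    qed
    then show "\<exists>N. \<forall>n\<ge>N. dist (harmonic_sum n) (harmonic_sum N) < e" by blast
  qed
  then have "harmonic_sum \<longlonglongrightarrow> L_one"
    unfolding L_one_def by (simp add: Cauchy_convergent_iff convergent_LIMSEQ_iff)
  then have "(\<lambda>N. norm (harmonic_sum N - harmonic_sum M)) \<longlonglongrightarrow> norm (L_one - harmonic_sum M)"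
    by (intro tendsto_intros)
  then have "norm (L_one - harmonic_sum M) \<le> 2 * real L / real (Suc M)"
    by (rule LIMSEQ_le_const2) (use norm_harmonic_sum_diff_le in blast)
  then show ?thesis by (simp add: norm_minus_commute)
qed

text \<open>The function ln x / x decreases only beyond e, so partial summation starts at 3 and the
  first two terms are bounded separately.\<close>

lemma bounded_ln_sum:
  obtains C where "\<And>N. norm (\<Sum>n=1..N. \<psi> n * of_real (ln (real n) / real n)) \<le> C"
proof
  fix N :: nat
  let ?f = "\<lambda>n. ln (real n) / real n"
  let ?g = "\<lambda>n. \<psi> n * of_real (?f n)"
  have pos: "2 * real L * ?f 3 \<ge> 0" by simp
  show "norm (\<Sum>n=1..N. ?g n) \<le> (\<Sum>n=1..2. norm (?g n)) + 2 * real L * ?f 3"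
  proof (cases "N \<ge> 2")
    case False
    have "norm (\<Sum>n=1..N. ?g n) \<le> (\<Sum>n=1..N. norm (?g n))" by (rule norm_sum)
    also have "\<dots> \<le> (\<Sum>n=1..2. norm (?g n))" using False by (intro sum_mono2) auto
    finally show ?thesis using pos by linarith
  next
    case True
    have anti: "?f (Suc n) \<le> ?f n" if "n \<ge> 3" for n
    proof -
      have "ln (1 + 1 / real n) \<le> 1 / real n" using that by (intro ln_add_one_self_le_self) auto
      moreover have "1 + 1 / real n = real (Suc n) / real n" using that by (simp add: field_simps)
      ultimately have "ln (real (Suc n)) - ln (real n) \<le> 1 / real n"
        using that by (simp add: ln_div)
      then have 1: "real n * (ln (real (Suc n)) - ln (real n)) \<le> 1" using that by (simp add: field_simps)
      have "exp 1 \<le> real n" using exp_le that by linarith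
      then have "1 \<le> ln (real n)" using that by (subst ln_ge_iff) auto
      with 1 have "real n * ln (real (Suc n)) \<le> real (Suc n) * ln (real n)"
        by (simp add: algebra_simps)
      then show ?thesis using that by (simp add: field_simps)
    qed
    have "{1..N} = {1..2} \<union> {3..<Suc N}" using True by auto
    then have eq: "(\<Sum>n=1..N. ?g n) = (\<Sum>n=1..2. ?g n) + (\<Sum>n\<in>{3..<Suc N}. ?g n)"
      by (simp only: ) (rule sum.union_disjoint; auto)
    have "norm (\<Sum>n\<in>{3..<Suc N}. ?g n) \<le> 2 * real L * ?f 3"
      using anti True by (intro norm_sum_antimono_le) auto
    moreover have "norm (\<Sum>n=1..2. ?g n) \<le> (\<Sum>n=1..2. norm (?g n))" by (rule norm_sum)
    ultimately show ?thesis
      unfolding eq using norm_triangle_ineq[of "\<Sum>n=1..2. ?g n" "\<Sum>n\<in>{3..<Suc N}. ?g n"] by linarith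
  qed
qed

text \<open>Writing ln n as the divisor sum of Lambda turns the bounded sum of
  \<open>\<psi> n\<close> ln n / n into a sum over d of \<open>\<psi> d\<close> Lambda(d) / d times
  \<open>harmonic_sum (N div d)\<close>. Replacing the inner sum by \<open>L_one\<close> costs at
  most Lambda(d) * 2 * L / N, since d * (\<open>N div d\<close> + 1) \<ge> N; by Chebyshev's bound
  the total error is at most 8 * L. Division by \<open>L_one\<close> finishes.\<close>

lemma bounded_mangoldt_sum:
  assumes "L_one \<noteq> 0"
  obtains C where "\<And>N. norm (mangoldt_sum N) \<le> C"
proof -
  obtain C where C: "\<And>N. norm (\<Sum>n=1..N. \<psi> n * of_real (ln (real n) / real n)) \<le> C"
    using bounded_ln_sum by blast
  have "norm (mangoldt_sum N) \<le> (C + 8 * real L) / norm L_one" for N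
  proof -
    let ?E = "\<Sum>d=1..N. \<psi> d * mangoldt d / of_nat d * (harmonic_sum (N div d) - L_one)"
    have "(\<Sum>n=1..N. \<psi> n * of_real (ln (real n) / real n))
        = (\<Sum>n=1..N. \<Sum>d | d dvd n. \<psi> d * mangoldt d / of_nat d * (\<psi> (n div d) / of_nat (n div d)))"
    proof (rule sum.cong)
      fix n assume "n \<in> {1..N}"
      then have n: "n > 0" by auto
      have "\<psi> n * of_real (ln (real n) / real n) = \<psi> n / of_nat n * (\<Sum>d | d dvd n. mangoldt d)"
        using n by (subst Prime_Powers.mangoldt_sum) auto
      also have "\<dots> = (\<Sum>d | d dvd n. \<psi> n / of_nat n * mangoldt d)" by (rule sum_distrib_left)
      also have "\<dots> = (\<Sum>d | d dvd n. \<psi> d * mangoldt d / of_nat d * (\<psi> (n div d) / of_nat (n div d)))"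
        using n by (intro sum.cong) (auto simp only: div_of_dvd mem_Collect_eq times_divide_eq_left times_divide_eq_right divide_divide_eq_left mult_ac)
      finally show "\<psi> n * of_real (ln (real n) / real n)
          = (\<Sum>d | d dvd n. \<psi> d * mangoldt d / of_nat d * (\<psi> (n div d) / of_nat (n div d)))" .
    qed simp
    also have "\<dots> = (\<Sum>d=1..N. \<Sum>m=1..N div d. \<psi> d * mangoldt d / of_nat d * (\<psi> m / of_nat m))"
      by (rule sum_divisors_swap)
    also have "\<dots> = (\<Sum>d=1..N. \<psi> d * mangoldt d / of_nat d * harmonic_sum (N div d))"
      by (simp only: harmonic_sum_def sum_distrib_left)
    also have "\<dots> = mangoldt_sum N * L_one + ?E"
      by (simp add: mangoldt_sum_def sum_distrib_right sum.distrib[symmetric] right_diff_distrib)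
    finally have eq: "mangoldt_sum N * L_one = (\<Sum>n=1..N. \<psi> n * of_real (ln (real n) / real n)) - ?E"
      by simp
    have "norm ?E \<le> (\<Sum>d=1..N. mangoldt d * (2 * real L / real N))"
    proof (rule sum_norm_le)
      fix d assume d: "d \<in> {1..N}"
      have "norm (\<psi> d * mangoldt d / of_nat d * (harmonic_sum (N div d) - L_one))
          = norm (\<psi> d) * mangoldt d / real d * norm (harmonic_sum (N div d) - L_one)"
        by (simp add: norm_mult norm_divide)
      also have "\<dots> \<le> 1 * mangoldt d / real d * (2 * real L / real (Suc (N div d)))"
        by (intro mult_mono divide_right_mono mult_right_mono norm_le_1 norm_harmonic_sum_minus_L_one_le)
           (auto simp: mangoldt_nonneg)
      also have "\<dots> = mangoldt d * (2 * real L / (real d * (real (N div d) + 1)))"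
        by (simp add: field_simps)
      also have "\<dots> \<le> mangoldt d * (2 * real L / real N)"
      proof (intro mult_left_mono divide_left_mono mangoldt_nonneg)
        show "real N \<le> real d * (real (N div d) + 1)"
          using of_nat_le_div_add_one[of d N] d by (simp add: field_simps)
      qed (use d in auto)
      finally show "norm (\<psi> d * mangoldt d / of_nat d * (harmonic_sum (N div d) - L_one))
          \<le> mangoldt d * (2 * real L / real N)" .
    qed
    also have "\<dots> = chebyshev_psi N * (2 * real L / real N)"
      unfolding chebyshev_psi_def by (rule sum_distrib_right[symmetric])
    also have "\<dots> \<le> 4 * real N * (2 * real L / real N)"
      by (intro mult_right_mono chebyshev_psi_le) auto
    also have "\<dots> \<le> 8 * real L" by (cases "N = 0") auto
    finally have "norm (mangoldt_sum N * L_one) \<le> C + 8 * real L"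
      unfolding eq using C[of N] norm_triangle_ineq4 by (meson add_mono order.trans)
    then show ?thesis using assms by (simp add: norm_mult field_simps)
  qed
  then show ?thesis using that by blast
qed

text \<open>The divisor sum of mu(d) ln(N / d) is Lambda(n), plus ln N at n = 1. Exchanging the sums
  leaves the factors \<open>harmonic_sum (N div d)\<close>, which are of order d / N because their
  limit is 0; what remains is the sum of ln(N / d), at most N by \<open>ln_fact_ge\<close>.\<close>

lemma mangoldt_sum_if_L_one_eq_0:
  assumes "L_one = 0" "N > 0"
  shows "norm (mangoldt_sum N + of_real (ln (real N))) \<le> 2 * real L"
proof -
  let ?m = "\<lambda>d. moebius_mu d * (ln (real N) - ln (real d))"
  have "mangoldt_sum N + of_real (ln (real N))
      = (\<Sum>n=1..N. \<psi> n / of_nat n * (\<Sum>d | d dvd n. of_real (?m d)))"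
  proof -
    have "(\<Sum>d | d dvd n. ?m d) = (if n = 1 then ln (real N) else 0) + mangoldt n" if "n > 0" for n
    proof -
      have "(\<Sum>d | d dvd n. ?m d)
          = (\<Sum>d | d dvd n. moebius_mu d) * ln (real N) - (\<Sum>d | d dvd n. moebius_mu d * ln (real d))"
        by (simp add: sum_subtractf sum_distrib_right right_diff_distrib)
      then show ?thesis using that by (simp add: sum_moebius_mu_divisors sum_moebius_mu_ln)
    qed
    then have *: "(\<Sum>d | d dvd n. complex_of_real (?m d))
        = (if n = 1 then of_real (ln (real N)) else 0) + mangoldt n" if "n > 0" for n
      using that by (simp only: of_real_sum[symmetric]) simp
    have "(\<Sum>n=1..N. \<psi> n / of_nat n * (\<Sum>d | d dvd n. of_real (?m d)))
        = (\<Sum>n=1..N. (if n = 1 then of_real (ln (real N)) else 0) + \<psi> n * mangoldt n / of_nat n)"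
    proof (rule sum.cong)
      fix n assume "n \<in> {1..N}"
      then have "n > 0" by simp
      show "\<psi> n / of_nat n * (\<Sum>d | d dvd n. of_real (?m d))
          = (if n = 1 then of_real (ln (real N)) else 0) + \<psi> n * mangoldt n / of_nat n"
        unfolding *[OF \<open>n > 0\<close>] by simp
    qed simp
    then show ?thesis using assms by (simp add: sum.distrib mangoldt_sum_def)
  qed
  also have "\<dots> = (\<Sum>n=1..N. \<Sum>d | d dvd n. \<psi> d * of_real (?m d) / of_nat d * (\<psi> (n div d) / of_nat (n div d)))"
  proof (rule sum.cong)
    fix n assume "n \<in> {1..N}"
    then have n: "n > 0" by auto
    have "\<psi> n / of_nat n * (\<Sum>d | d dvd n. of_real (?m d)) = (\<Sum>d | d dvd n. \<psi> n / of_nat n * of_real (?m d))"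
      by (rule sum_distrib_left)
    also have "\<dots> = (\<Sum>d | d dvd n. \<psi> d * of_real (?m d) / of_nat d * (\<psi> (n div d) / of_nat (n div d)))"
      using n by (intro sum.cong) (auto simp only: div_of_dvd mem_Collect_eq times_divide_eq_left times_divide_eq_right divide_divide_eq_left mult_ac)
    finally show "\<psi> n / of_nat n * (\<Sum>d | d dvd n. of_real (?m d))
        = (\<Sum>d | d dvd n. \<psi> d * of_real (?m d) / of_nat d * (\<psi> (n div d) / of_nat (n div d)))" .
  qed simp
  also have "\<dots> = (\<Sum>d=1..N. \<Sum>m=1..N div d. \<psi> d * of_real (?m d) / of_nat d * (\<psi> m / of_nat m))"
    by (rule sum_divisors_swap)
  also have "\<dots> = (\<Sum>d=1..N. \<psi> d * of_real (?m d) / of_nat d * harmonic_sum (N div d))"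
    by (simp only: harmonic_sum_def sum_distrib_left)
  also have "norm \<dots> \<le> (\<Sum>d=1..N. (ln (real N) - ln (real d)) * (2 * real L / real N))"
  proof (rule sum_norm_le)
    fix d assume d: "d \<in> {1..N}"
    then have nn: "ln (real N) - ln (real d) \<ge> 0" by auto
    have "norm (\<psi> d * of_real (?m d) / of_nat d * harmonic_sum (N div d))
        = norm (\<psi> d) * (\<bar>moebius_mu d\<bar> * \<bar>ln (real N) - ln (real d)\<bar>) / real d * norm (harmonic_sum (N div d))"
      by (simp only: norm_mult norm_divide norm_of_real norm_of_nat abs_mult)
    also have "\<dots> \<le> 1 * (1 * \<bar>ln (real N) - ln (real d)\<bar>) / real d * (2 * real L / real (Suc (N div d)))"
      using norm_harmonic_sum_minus_L_one_le[of "N div d"] assms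
      by (intro mult_mono divide_right_mono norm_le_1 abs_moebius_mu_le) auto
    also have "\<dots> = (ln (real N) - ln (real d)) * (2 * real L / (real d * (real (N div d) + 1)))"
      using nn by (simp add: field_simps)
    also have "\<dots> \<le> (ln (real N) - ln (real d)) * (2 * real L / real N)"
    proof (intro mult_left_mono divide_left_mono nn)
      show "real N \<le> real d * (real (N div d) + 1)"
        using of_nat_le_div_add_one[of d N] d by (simp add: field_simps)
    qed (use d in auto)
    finally show "norm (\<psi> d * of_real (?m d) / of_nat d * harmonic_sum (N div d))
        \<le> (ln (real N) - ln (real d)) * (2 * real L / real N)" .
  qed
  also have "\<dots> = (\<Sum>d=1..N. ln (real N) - ln (real d)) * (2 * real L / real N)"
    by (rule sum_distrib_right[symmetric])
  also have "(\<Sum>d=1..N. ln (real N) - ln (real d)) = real N * ln (real N) - ln (fact N)"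
    by (simp add: sum_subtractf ln_fact_sum)
  also have "(real N * ln (real N) - ln (fact N)) * (2 * real L / real N) \<le> real N * (2 * real L / real N)"
    using ln_fact_ge[of N] by (intro mult_right_mono) auto
  also have "\<dots> = 2 * real L" using assms by simp
  finally show ?thesis .
qed

text \<open>An upper bound on the real part holds whether or not \<open>L_one\<close> vanishes. It
  is applied to the square of a character, about whose value at 1 nothing is known at that
  point.\<close>

lemma bounded_Re_mangoldt_sum:
  obtains C where "\<And>N. N > 0 \<Longrightarrow> Re (mangoldt_sum N) \<le> C"
proof (cases "L_one = 0")
  case True
  have "Re (mangoldt_sum N) \<le> 2 * real L" if "N > 0" for N
  proof -
    have "Re (mangoldt_sum N) + ln (real N) \<le> 2 * real L"
      using mangoldt_sum_if_L_one_eq_0[OF True that]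
        complex_Re_le_cmod[of "mangoldt_sum N + of_real (ln (real N))"] by simp
    moreover have "ln (real N) \<ge> 0" using that by simp
    ultimately show ?thesis by linarith
  qed
  then show ?thesis using that by blast
next
  case False
  then obtain C where "\<And>N. norm (mangoldt_sum N) \<le> C" using bounded_mangoldt_sum by blast
  then show ?thesis using that complex_Re_le_cmod order.trans by blast
qed

text \<open>The weights come from \<open>3 + 4 cos \<theta> + cos (2\<theta>) = 2 (1 + cos \<theta>)\<^sup>2\<close>: a zero of
  \<open>L(1,\<psi>)\<close> would contribute \<open>-4 ln N\<close> to a nonnegative sum in which the principal character
  contributes at most \<open>3 ln N\<close>.\<close>

lemma L_one_neq_0_if_square_nonprincipal:
  assumes "coprime m L" "\<psi> m ^ 2 \<noteq> 1"
  shows "L_one \<noteq> 0"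
proof
  assume L0: "L_one = 0"
  interpret sq: nonprincipal_character L "\<lambda>n. \<psi> n ^ 2"
  proof unfold_locales
    show "\<exists>m. coprime m L \<and> (\<psi> m)\<^sup>2 \<noteq> 1" using assms by blast
  qed (auto simp: modulus_pos mult power_mult_distrib periodic norm_power norm_eq_1 eq_zero)
  obtain C where C: "\<And>N. N > 0 \<Longrightarrow> Re (sq.mangoldt_sum N) \<le> C"
    using sq.bounded_Re_mangoldt_sum by blast
  \<comment> \<open>Here 12 is 3 times the constant 4 of \<open>mertens_upper\<close>, and 8 * L is
    4 times the error 2 * L of \<open>mangoldt_sum_if_L_one_eq_0\<close>; the coefficients 3 and -4
    of ln N leave -1.\<close>
  have "ln (real N) \<le> 12 + 8 * real L + C" if N: "N > 0" for N
  proof -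
    have pointwise: "0 \<le> 3 + 4 * Re (\<psi> n) + Re (\<psi> n ^ 2)" for n
    proof (cases "coprime n L")
      case True
      then have "Re (\<psi> n) ^ 2 + Im (\<psi> n) ^ 2 = 1"
        using norm_eq_1[of n] cmod_power2[of "\<psi> n"] by simp
      then have "3 + 4 * Re (\<psi> n) + Re (\<psi> n ^ 2) = 2 * (1 + Re (\<psi> n)) ^ 2"
        by (simp add: power2_eq_square algebra_simps)
      then show ?thesis by simp
    qed (simp add: eq_zero)
    have "0 \<le> (\<Sum>n=1..N. (3 + 4 * Re (\<psi> n) + Re (\<psi> n ^ 2)) * (mangoldt n / real n))"
      by (intro sum_nonneg mult_nonneg_nonneg pointwise divide_nonneg_nonneg mangoldt_nonneg) auto
    also have "\<dots> = 3 * (\<Sum>n=1..N. mangoldt n / real n) + 4 * Re (mangoldt_sum N) + Re (sq.mangoldt_sum N)"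
      by (simp add: mangoldt_sum_def sq.mangoldt_sum_def sum_distrib_left sum.distrib algebra_simps
          Re_divide_of_nat del: Re_power2)
    finally have 1: "0 \<le> 3 * (\<Sum>n=1..N. mangoldt n / real n) + 4 * Re (mangoldt_sum N) + Re (sq.mangoldt_sum N)" .
    have "Re (mangoldt_sum N) + ln (real N) \<le> 2 * real L"
      using mangoldt_sum_if_L_one_eq_0[OF L0 N]
        complex_Re_le_cmod[of "mangoldt_sum N + of_real (ln (real N))"] by simp
    with 1 C[OF N] mertens_upper[OF N] show ?thesis by linarith
  qed
  moreover have "filterlim (\<lambda>N. ln (real N)) at_top sequentially" by real_asymp
  ultimately show False
    by (auto simp: filterlim_at_top_dense eventually_sequentially dest!: spec[of _ "12 + 8 * real L + C"])
       (meson max.cobounded1 max.cobounded2 less_le_not_le zero_less_Suc order_less_le_trans)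
qed

end

section \<open>Real characters: divisor sums and Lambert weights\<close>

lemma sum_divisors_prime_power_mult:
  fixes f :: "nat \<Rightarrow> 'a::comm_monoid_add"
  assumes p: "prime p" and m: "\<not> p dvd m"
  shows "(\<Sum>d | d dvd p ^ k * m. f d) = (\<Sum>i\<le>k. \<Sum>d | d dvd m. f (p ^ i * d))"
proof -
  have m0: "m > 0" using m by (intro Nat.gr0I notI) auto
  have p0: "p > 0" using p prime_gt_0_nat by blast
  have mult: "multiplicity p (p ^ i * d) = i" if "\<not> p dvd d" for i d
    using that p p0 by (intro multiplicity_eqI) (auto simp: dvd_mult_cancel1)
  have "(\<Sum>i\<le>k. \<Sum>d | d dvd m. f (p ^ i * d)) = (\<Sum>(i,d)\<in>{..k} \<times> {d. d dvd m}. f (p ^ i * d))"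
    by (rule sum.cartesian_product)
  also have "\<dots> = (\<Sum>d | d dvd p ^ k * m. f d)"
  proof (rule sum.reindex_bij_witness[of _ "\<lambda>x. (multiplicity p x, x div p ^ multiplicity p x)" "\<lambda>(i,d). p ^ i * d"])
    fix a assume a: "a \<in> {..k} \<times> {d. d dvd m}"
    obtain i d where id: "a = (i, d)" by force
    with a have "i \<le> k" "d dvd m" by auto
    moreover from this m have "\<not> p dvd d" by auto
    ultimately show "(multiplicity p (case a of (i,d) \<Rightarrow> p ^ i * d),
        (case a of (i,d) \<Rightarrow> p ^ i * d) div p ^ multiplicity p (case a of (i,d) \<Rightarrow> p ^ i * d)) = a"
      "(case a of (i,d) \<Rightarrow> p ^ i * d) \<in> {d. d dvd p ^ k * m}"
      using p0 by (auto simp: id mult intro!: mult_dvd_mono le_imp_power_dvd)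
  next
    fix x assume "x \<in> {d. d dvd p ^ k * m}"
    then have x: "x dvd p ^ k * m" by simp
    then have x0: "x \<noteq> 0" using m0 p0 by (intro notI) auto
    then obtain d where d: "x = p ^ multiplicity p x * d" "\<not> p dvd d"
      using multiplicity_decompose'[of x p] p by (metis not_prime_unit)
    let ?i = "multiplicity p x"
    have "p ^ ?i dvd p ^ k * m" using x d(1) dvd_mult_left by metis
    moreover have "coprime (p ^ ?i) m" using p m by (simp add: prime_imp_coprime)
    ultimately have "p ^ ?i dvd p ^ k" by (simp add: coprime_dvd_mult_left_iff)
    then have "?i \<le> k" using p by (simp add: dvd_power_iff_le prime_ge_2_nat)
    moreover have "d dvd m"
    proof -
      have "d dvd p ^ k * m" using x d(1) dvd_mult_right by metis
      moreover have "coprime d (p ^ k)"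
        using prime_imp_coprime[OF p d(2)] by (simp add: coprime_commute)
      ultimately show ?thesis by (simp add: coprime_dvd_mult_right_iff)
    qed
    moreover have "x div p ^ ?i = d" using d(1) p0 by (metis nonzero_mult_div_cancel_left power_eq_0_iff less_not_refl)
    ultimately show "(multiplicity p x, x div p ^ multiplicity p x) \<in> {..k} \<times> {d. d dvd m}"
      "(case (multiplicity p x, x div p ^ multiplicity p x) of (i,d) \<Rightarrow> p ^ i * d) = x"
      using d(1) by auto
  qed auto
  finally show ?thesis by simp
qed

text \<open>Even multiplicities characterise the perfect squares.\<close>

lemma sum_divisors_quadratic:
  fixes g :: "nat \<Rightarrow> real"
  assumes mult: "\<And>m n. g (m * n) = g m * g n" and one: "g 1 = 1"
    and val: "\<And>n. g n \<in> {-1, 0, 1}"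
    and "n > 0"
  shows "(\<Sum>d | d dvd n. g d) \<ge> 0 \<and>
    ((\<forall>p. prime p \<longrightarrow> even (multiplicity p n)) \<longrightarrow> (\<Sum>d | d dvd n. g d) \<ge> 1)"
  using \<open>n > 0\<close>
proof (induction n rule: less_induct)
  case (less n)
  show ?case
  proof (cases "n = 1")
    case True
    then show ?thesis using one by simp
  next
    case False
    then obtain p where p: "prime p" "p dvd n" using prime_factor_nat by blast
    define k where "k = multiplicity p n"
    obtain m where m: "n = p ^ k * m" "\<not> p dvd m"
      using multiplicity_decompose'[of n p] p less.prems unfolding k_def
      by (metis not_prime_unit less_not_refl)
    have k: "k > 0" using p less.prems by (simp add: k_def prime_multiplicity_gt_zero_iff)
    have p2: "p > 1" using p prime_gt_1_nat by blast
    have m0: "m > 0" using m less.prems by (intro Nat.gr0I notI) auto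
    have "p ^ k > 1" using p2 k by (rule one_less_power)
    then have "m < n" using m m0 by simp
    note IH = less.IH[OF this m0]
    have gpow: "g (p ^ i) = g p ^ i" for i by (induction i) (use mult one in auto)
    have eq: "(\<Sum>d | d dvd n. g d) = (\<Sum>i\<le>k. g p ^ i) * (\<Sum>d | d dvd m. g d)"
      unfolding m(1) sum_divisors_prime_power_mult[OF p(1) m(2)]
      by (simp add: mult gpow sum_product)
    have alt: "(\<Sum>i\<le>k. (-1::real) ^ i) = (if even k then 1 else 0)" for k
      by (induction k) auto
    have zero: "(\<Sum>i\<le>k. (0::real) ^ i) = 1" for k by (induction k) auto
    \<comment> \<open>The factor at p is k + 1 or 1 when g p is 1 or 0. When g p = -1 it is an
      alternating sum, equal to 1 for even k and 0 for odd k.\<close>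
    have F: "(\<Sum>i\<le>k. g p ^ i) \<ge> 0" "even k \<Longrightarrow> (\<Sum>i\<le>k. g p ^ i) \<ge> 1"
      using val[of p] by (auto simp: alt zero)
    have "(\<Sum>d | d dvd n. g d) \<ge> 1" if ev: "\<forall>q. prime q \<longrightarrow> even (multiplicity q n)"
    proof -
      have "even k" using ev p by (simp add: k_def)
      have "even (multiplicity q m)" if q: "prime q" for q
      proof (cases "q = p")
        case True
        then show ?thesis using m by (simp add: not_dvd_imp_multiplicity_0)
      next
        case False
        have "multiplicity q n = multiplicity q (p ^ k) + multiplicity q m"
          unfolding m(1) using q p2 m0 by (intro prime_elem_multiplicity_mult_distrib) auto
        also have "multiplicity q (p ^ k) = 0"
          using q p(1) False by (simp add: multiplicity_distinct_prime_power)
        finally show ?thesis using ev q by auto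
      qed
      with IH have "(\<Sum>d | d dvd m. g d) \<ge> 1" by blast
      with F(2)[OF \<open>even k\<close>] show ?thesis
        unfolding eq using mult_mono[of 1 "\<Sum>i\<le>k. g p ^ i" 1 "\<Sum>d | d dvd m. g d"] by simp
    qed
    moreover have "(\<Sum>d | d dvd n. g d) \<ge> 0" unfolding eq using F(1) IH by simp
    ultimately show ?thesis by blast
  qed
qed

text \<open>The inequality of arithmetic and geometric means, applied to the pairs of terms with
  exponents i and n - 1 - i. Squaring keeps the geometric mean, a power of sqrt t, out of the
  statement.\<close>

lemma geometric_sum_ge:
  fixes t :: real
  assumes "t > 0"
  shows "real n ^ 2 * t ^ (n - 1) \<le> (\<Sum>i<n. t ^ i) ^ 2"
proof -
  define u where "u = sqrt t"
  have u: "u > 0" "u ^ 2 = t" using assms by (auto simp: u_def)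
  have rev: "(\<Sum>i<n. t ^ (n - Suc i)) = (\<Sum>i<n. t ^ i)" by (rule sum.nat_diff_reindex)
  have "(\<Sum>i<n. 2 * u ^ (n - 1)) \<le> (\<Sum>i<n. t ^ i + t ^ (n - Suc i))"
  proof (rule sum_mono)
    fix i assume "i \<in> {..<n}"
    then have "u ^ (n - 1) = u ^ i * u ^ (n - Suc i)" by (simp flip: power_add)
    moreover have "2 * u ^ i * u ^ (n - Suc i) \<le> (u ^ i) ^ 2 + (u ^ (n - Suc i)) ^ 2"
      by (rule sum_squares_bound)
    moreover have "(u ^ j) ^ 2 = t ^ j" for j by (simp add: u(2)[symmetric] mult.commute flip: power_mult)
    ultimately show "2 * u ^ (n - 1) \<le> t ^ i + t ^ (n - Suc i)" by simp
  qed
  then have "2 * (real n * u ^ (n - 1)) \<le> 2 * (\<Sum>i<n. t ^ i)"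
    by (simp add: sum.distrib rev)
  then have "(real n * u ^ (n - 1)) ^ 2 \<le> (\<Sum>i<n. t ^ i) ^ 2"
    using u by (intro power_mono) auto
  moreover have "(real n * u ^ (n - 1)) ^ 2 = real n ^ 2 * t ^ (n - 1)"
    by (simp add: power_mult_distrib u(2)[symmetric] mult.commute flip: power_mult)
  ultimately show ?thesis by simp
qed

text \<open>The term t^n / (1 - t^n) of a Lambert series behaves like 1 / (n * (1 - t)) as t tends
  to 1; the weight is this pole minus the term. At n = 1 it equals 1 for every t < 1, which makes
  bounds by partial summation uniform in t.\<close>

definition lambert_weight :: "real \<Rightarrow> nat \<Rightarrow> real" where
  "lambert_weight t n = 1 / (real n * (1 - t)) - t ^ n / (1 - t ^ n)"

lemma lambert_weight_eq:
  assumes "0 < t" "t < 1" "n > 0"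
  shows "lambert_weight t n = (1 / real n - t ^ n / (\<Sum>i<n. t ^ i)) / (1 - t)"
proof -
  have "1 - t ^ n = (1 - t) * (\<Sum>i<n. t ^ i)" by (rule one_diff_power_eq)
  then show ?thesis using assms by (simp add: lambert_weight_def diff_divide_distrib)
qed

text \<open>With S n the geometric sum of n terms and the factor 1 - t cleared, the claim becomes
  t^n / (S n * S (n + 1)) \<le> 1 / (n * (n + 1)). The product of the bounds
  \<open>geometric_sum_ge\<close> for n and n + 1 gives its square with t^(2n - 1), and t^(2n) is
  smaller still.\<close>

lemma lambert_weight_antimono:
  assumes t: "0 < t" "t < 1" and n: "n > 0"
  shows "lambert_weight t (Suc n) \<le> lambert_weight t n"
proof -
  define S where "S k = (\<Sum>i<k. t ^ i)" for k
  have Spos: "S k > 0" if "k > 0" for k unfolding S_def using t that by (intro sum_pos) auto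
  have Sn: "S (Suc n) = 1 + t * S n"
    unfolding S_def by (simp add: sum.lessThan_Suc_shift sum_distrib_left del: sum.lessThan_Suc)
  have le: "real n * real (Suc n) * t ^ n \<le> S n * S (Suc n)"
  proof (rule power2_le_imp_le)
    have "(real n * real (Suc n) * t ^ n) ^ 2 = (t ^ (n + n) * (real n ^ 2 * real (Suc n) ^ 2))"
      by (simp add: power_mult_distrib power_add power2_eq_square)
    also have "\<dots> \<le> t ^ (n - 1 + n) * (real n ^ 2 * real (Suc n) ^ 2)"
      using t by (intro mult_right_mono power_decreasing) auto
    also have "\<dots> = (real n ^ 2 * t ^ (n - 1)) * (real (Suc n) ^ 2 * t ^ (Suc n - 1))"
      by (simp add: power_add)
    also have "\<dots> \<le> (S n) ^ 2 * (S (Suc n)) ^ 2"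
      unfolding S_def using t by (intro mult_mono geometric_sum_ge) auto
    finally show "(real n * real (Suc n) * t ^ n)\<^sup>2 \<le> (S n * S (Suc n))\<^sup>2"
      by (simp add: power_mult_distrib)
  qed (use Spos[of n] Spos[of "Suc n"] n in simp)
  have "t ^ n / S n - t ^ Suc n / S (Suc n) = t ^ n * (S (Suc n) - t * S n) / (S n * S (Suc n))"
    using Spos[of n] Spos[of "Suc n"] n by (simp add: field_simps)
  also have "\<dots> = t ^ n / (S n * S (Suc n))" by (simp add: Sn)
  also have "\<dots> \<le> 1 / (real n * real (Suc n))"
    using le Spos[of n] Spos[of "Suc n"] n by (simp add: divide_simps mult.commute)
  also have "\<dots> = 1 / real n - 1 / real (Suc n)" using n by (simp add: field_simps)
  finally have "1 / real (Suc n) - t ^ Suc n / S (Suc n) \<le> 1 / real n - t ^ n / S n" by simp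
  then show ?thesis
    unfolding lambert_weight_eq[OF t n] lambert_weight_eq[OF t zero_less_Suc] S_def[symmetric]
    using t by (intro divide_right_mono) auto
qed

lemma lambert_weight_nonneg:
  assumes t: "0 < t" "t < 1" and n: "n > 0"
  shows "lambert_weight t n \<ge> 0"
proof -
  have pos: "(\<Sum>i<n. t ^ i) > 0" using t n by (intro sum_pos) auto
  have "real n * t ^ n = (\<Sum>i<n. t ^ n)" by simp
  also have "\<dots> \<le> (\<Sum>i<n. t ^ i)" using t by (intro sum_mono power_decreasing) auto
  finally have "t ^ n / (\<Sum>i<n. t ^ i) \<le> 1 / real n" using pos n by (simp add: field_simps)
  then show ?thesis using t n by (simp add: lambert_weight_eq)
qed

lemma geometric_sum_truncation:
  fixes x :: real
  assumes "x \<noteq> 1"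
  shows "(\<Sum>m=1..M. x ^ m) = x / (1 - x) - x ^ Suc M / (1 - x)"
proof -
  have "(\<Sum>m=1..M. x ^ m) * (1 - x) = x - x ^ Suc M"
  proof (induction M)
    case (Suc M)
    then show ?case by (simp add: distrib_right) (simp add: algebra_simps)
  qed simp
  with assms show ?thesis by (simp add: eq_divide_eq flip: diff_divide_distrib)
qed

context nonprincipal_character
begin

text \<open>Monsky's argument. If \<open>L(1,\<psi>) = 0\<close>, then the Lambert series
  \<open>\<Sum> \<psi>(n) t\<^sup>n / (1 - t\<^sup>n)\<close> stays bounded as \<open>t\<close> tends to 1, by partial summation against
  the decreasing weights \<open>lambert_weight\<close>; but its power series coefficients
  \<open>\<Sum> \<psi>(d)\<close>, \<open>d\<close> dividing \<open>n\<close>, are nonnegative, and at least 1 at perfect squares.\<close>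

lemma L_one_neq_0_if_quadratic:
  assumes quad: "\<And>m. coprime m L \<Longrightarrow> \<psi> m ^ 2 = 1"
  shows "L_one \<noteq> 0"
proof
  assume L0: "L_one = 0"
  define g where "g n = Re (\<psi> n)" for n
  have vals: "\<psi> n \<in> {-1, 0, 1}" for n
    using quad[of n] eq_zero[of n] by (cases "coprime n L") (auto simp: power2_eq_1_iff)
  have g: "\<psi> n = of_real (g n)" for n using vals[of n] by (auto simp: g_def)
  have gval: "g n \<in> {-1, 0, 1}" for n using vals[of n] by (auto simp: g_def)
  have gmult: "g (m * n) = g m * g n" for m n
    using mult[of m n] by (simp add: g flip: of_real_mult)
  have g1: "g 1 = 1" by (simp add: g_def)
  have gabs: "\<bar>g n\<bar> \<le> 1" for n using gval[of n] by auto
  define r where "r n = (\<Sum>d | d dvd n. g d)" for n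
  have r: "r n \<ge> 0" "(\<forall>p. prime p \<longrightarrow> even (multiplicity p n)) \<Longrightarrow> r n \<ge> 1" if "n > 0" for n
    using sum_divisors_quadratic[OF gmult g1 gval that] by (auto simp: r_def)
  have r_square: "r (n ^ 2) \<ge> 1" if "n > 0" for n
    using that by (intro r) (auto simp: prime_elem_multiplicity_power_distrib)
  have bound: "(\<Sum>j=1..J. t ^ (j ^ 2)) \<le> 2 * real L" if t: "0 < t" "t < 1" for t :: real and J :: nat
  proof -
    \<comment> \<open>K truncates the power series. For fixed t both extra terms vanish as K grows:
      one comes from the tail of \<open>harmonic_sum\<close>, the other from cutting the inner
      geometric series.\<close>
    have upper: "(\<Sum>n=1..K. r n * t ^ n)
        \<le> 2 * real L + 2 * real L / real (Suc K) / (1 - t) + real K * t ^ K / (1 - t)" for K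
    proof -
      have "(\<Sum>n=1..K. r n * t ^ n) = (\<Sum>n=1..K. \<Sum>d | d dvd n. g d * (t ^ d) ^ (n div d))"
        unfolding r_def sum_distrib_right
        by (intro sum.cong) (auto simp flip: power_mult)
      also have "\<dots> = (\<Sum>d=1..K. g d * (\<Sum>m=1..K div d. (t ^ d) ^ m))"
        by (subst sum_divisors_swap[of "\<lambda>d m. g d * (t ^ d) ^ m"]) (simp add: sum_distrib_left)
      also have "\<dots> \<le> (\<Sum>d=1..K. g d / real d / (1 - t) - g d * lambert_weight t d + t ^ K / (1 - t))"
      proof (rule sum_mono)
        fix d assume d: "d \<in> {1..K}"
        have td: "t ^ d < 1" "t ^ d > 0" "t ^ d \<le> t" using t d
          by (auto intro!: power_less_one_iff[THEN iffD2] power_le_one) (metis One_nat_def less_eq_real_def power_decreasing power_one_right)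
        define E where "E = (t ^ d) ^ Suc (K div d) / (1 - t ^ d)"
        have "K \<le> d * Suc (K div d)"
          using d dividend_less_times_div[of d K] by simp
        then have "(t ^ d) ^ Suc (K div d) \<le> t ^ K"
          unfolding power_mult[symmetric] using t by (intro power_decreasing) auto
        then have E: "0 \<le> E" "E \<le> t ^ K / (1 - t)"
          unfolding E_def using t td by (auto intro!: frac_le)
        have "\<bar>g d * E\<bar> \<le> 1 * (t ^ K / (1 - t))"
          unfolding abs_mult using E gabs[of d] by (intro mult_mono) auto
        then have gE: "- (g d * E) \<le> t ^ K / (1 - t)" by linarith
        have "(\<Sum>m=1..K div d. (t ^ d) ^ m) = t ^ d / (1 - t ^ d) - E"
          using td geometric_sum_truncation[of "t ^ d" "K div d"] by (simp add: E_def)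
        \<comment> \<open>The pole part, summed against g, is a partial sum for \<open>L_one\<close>
          divided by 1 - t; this is where the assumption \<open>L0\<close> acts.\<close>
        also have "t ^ d / (1 - t ^ d) = 1 / (real d * (1 - t)) - lambert_weight t d"
          by (simp add: lambert_weight_def)
        finally have "g d * (\<Sum>m=1..K div d. (t ^ d) ^ m)
            = g d / real d / (1 - t) - g d * lambert_weight t d - g d * E"
          by (simp only: right_diff_distrib) (simp add: right_diff_distrib)
        with gE show "g d * (\<Sum>m=1..K div d. (t ^ d) ^ m)
            \<le> g d / real d / (1 - t) - g d * lambert_weight t d + t ^ K / (1 - t)" by linarith
      qed
      also have "\<dots> = (\<Sum>d=1..K. g d / real d) / (1 - t) - (\<Sum>d=1..K. g d * lambert_weight t d)
          + real K * t ^ K / (1 - t)"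
        by (simp add: sum.distrib sum_subtractf sum_divide_distrib)
      finally have split: "(\<Sum>n=1..K. r n * t ^ n) \<le> (\<Sum>d=1..K. g d / real d) / (1 - t)
          - (\<Sum>d=1..K. g d * lambert_weight t d) + real K * t ^ K / (1 - t)" .
      have "(\<Sum>d=1..K. g d / real d) / (1 - t) \<le> 2 * real L / real (Suc K) / (1 - t)"
      proof (rule divide_right_mono)
        have "harmonic_sum K = of_real (\<Sum>d=1..K. g d / real d)"
          by (simp add: harmonic_sum_def g)
        then have "\<bar>\<Sum>d=1..K. g d / real d\<bar> = norm (harmonic_sum K)" by (simp only: norm_of_real)
        also have "\<dots> \<le> 2 * real L / real (Suc K)"
          using norm_harmonic_sum_minus_L_one_le[of K] by (simp add: L0)
        finally show "(\<Sum>d=1..K. g d / real d) \<le> 2 * real L / real (Suc K)" by linarith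
      qed (use t in auto)
      moreover have "- (\<Sum>d=1..K. g d * lambert_weight t d) \<le> 2 * real L"
      proof -
        have "norm (\<Sum>d\<in>{1..<Suc K}. \<psi> d * of_real (lambert_weight t d)) \<le> 2 * real L * lambert_weight t 1"
          using lambert_weight_antimono lambert_weight_nonneg t by (intro norm_sum_antimono_le) auto
        also have "lambert_weight t 1 = 1" using t by (simp add: lambert_weight_def field_simps)
        also have "(\<Sum>d\<in>{1..<Suc K}. \<psi> d * of_real (lambert_weight t d))
            = of_real (\<Sum>d=1..K. g d * lambert_weight t d)"
          by (simp add: g atLeastLessThanSuc_atLeastAtMost)
        finally show ?thesis unfolding norm_of_real by linarith
      qed
      ultimately show ?thesis using split by linarith
    qed
    have lower: "(\<Sum>j=1..J. t ^ (j ^ 2)) \<le> (\<Sum>n=1..K. r n * t ^ n)" if K: "K \<ge> J ^ 2" for K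
    proof -
      have inj: "inj_on (\<lambda>j::nat. j ^ 2) {1..J}" by (auto simp: inj_on_def)
      have "(\<Sum>j=1..J. t ^ (j ^ 2)) \<le> (\<Sum>j=1..J. r (j ^ 2) * t ^ (j ^ 2))"
        using t r_square by (intro sum_mono) simp
      also have "\<dots> = (\<Sum>n\<in>(\<lambda>j. j ^ 2) ` {1..J}. r n * t ^ n)"
        using inj by (simp add: sum.reindex)
      also have "\<dots> \<le> (\<Sum>n=1..K. r n * t ^ n)"
      proof (rule sum_mono2)
        show "(\<lambda>j. j ^ 2) ` {1..J} \<subseteq> {1..K}"
        proof safe
          fix j :: nat assume "j \<in> {1..J}"
          then have "1 \<le> j" "j ^ 2 \<le> J ^ 2" by (auto simp: power_mono)
          from order.trans[OF this(2) K] this(1) show "j ^ 2 \<in> {1..K}" by simp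
        qed
      qed (use r t in auto)
      finally show ?thesis .
    qed
    have "(\<lambda>K. real K * t ^ K) \<longlonglongrightarrow> 0"
      using powser_times_n_limit_0[of t] t by simp
    then have "(\<lambda>K. 2 * real L + 2 * real L / real (Suc K) / (1 - t) + real K * t ^ K / (1 - t))
        \<longlonglongrightarrow> 2 * real L + 0 / (1 - t) + 0 / (1 - t)"
      using t by (intro tendsto_intros tendsto_divide[OF _ tendsto_const] LIMSEQ_Suc lim_const_over_n) auto
    then have "(\<Sum>j=1..J. t ^ (j ^ 2)) \<le> 2 * real L + 0 / (1 - t) + 0 / (1 - t)"
      by (rule LIMSEQ_le_const) (use upper lower order.trans in blast)
    then show ?thesis by simp
  qed
  \<comment> \<open>J exceeds 4 * L, and t is so close to 1 that Bernoulli's inequality keeps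
    t^(j^2) \<ge> 1 / 2 for all j \<le> J. The J squares then contribute more than the bound 2 *
    L.\<close>
  define J where "J = 4 * L + 1"
  define t :: real where "t = 1 - 1 / (2 * real J ^ 2)"
  have J1: "real J ^ 2 \<ge> 1" by (simp add: J_def)
  have "J > 0" by (simp add: J_def)
  then have "0 < 1 / (2 * real J ^ 2)" by simp
  moreover have "1 / (2 * real J ^ 2) \<le> 1 / 2" by (rule frac_le) (use J1 in linarith)+
  ultimately have t: "0 < t" "t < 1" unfolding t_def by linarith+
  have "1 / 2 = 1 + real (J ^ 2) * (- 1 / (2 * real J ^ 2))" using J1 \<open>J > 0\<close> by (simp add: field_simps)
  also have "\<dots> \<le> (1 + - 1 / (2 * real J ^ 2)) ^ (J ^ 2)"
    using t(1) unfolding t_def by (intro Bernoulli_inequality) simp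
  also have "\<dots> = t ^ (J ^ 2)" by (simp add: t_def)
  finally have half: "1 / 2 \<le> t ^ (J ^ 2)" .
  have "real J * (1 / 2) = (\<Sum>j=1..J. 1 / 2)" by simp
  also have "\<dots> \<le> (\<Sum>j=1..J. t ^ (j ^ 2))"
  proof (rule sum_mono)
    fix j assume "j \<in> {1..J}"
    then have "t ^ (J ^ 2) \<le> t ^ (j ^ 2)" using t by (intro power_decreasing power_mono) auto
    with half show "1 / 2 \<le> t ^ (j ^ 2)" by linarith
  qed
  also have "\<dots> \<le> 2 * real L" using bound t by blast
  finally show False by (simp add: J_def)
qed

theorem L_one_neq_0: "L_one \<noteq> 0"
  using L_one_neq_0_if_quadratic L_one_neq_0_if_square_nonprincipal by blast

end

section \<open>Primes in arithmetic progressions of squarefree modulus\<close>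

text \<open>The discrete logarithm to a fixed primitive root. The exponent is an arbitrary choice,
  determined only modulo q - 1, so its laws are stated as congruences; its value at multiples of q
  is never consulted by \<open>prime_character\<close>.\<close>

definition prime_index :: "nat \<Rightarrow> nat \<Rightarrow> nat" where
  "prime_index q n = (SOME i. [(SOME g. residue_primroot q g) ^ i = n] (mod q))"

lemma prime_index_primroot:
  assumes q: "prime q"
  obtains g where "residue_primroot q g" "\<And>n. \<not> q dvd n \<Longrightarrow> [g ^ prime_index q n = n] (mod q)"
proof -
  define g where "g = (SOME g. residue_primroot q g)"
  have q1: "q > 1" using q prime_gt_1_nat by blast
  have "\<exists>g. residue_primroot q g" by (rule prime_primitive_root_exists) (use q1 q in auto)
  then have g: "residue_primroot q g" unfolding g_def by (rule someI_ex)
  have "[g ^ prime_index q n = n] (mod q)" if "\<not> q dvd n" for n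
  proof -
    have "n mod q \<in> totatives q"
      using that q q1 prime_imp_coprime[OF q that]
      by (auto simp: totatives_def coprime_commute dvd_eq_mod_eq_0 less_imp_le)
    also have "totatives q = (\<lambda>i. g ^ i mod q) ` {..<totient q}"
      using residue_primroot_is_generator[OF q1 g] by (simp add: bij_betw_def)
    finally have "\<exists>i. [g ^ i = n] (mod q)" by (auto simp: cong_def)
    then show ?thesis unfolding prime_index_def g_def by (rule someI_ex)
  qed
  with g show ?thesis by (rule that)
qed

text \<open>The j-th power of one generating character; j < q - 1 runs through the whole character
  group modulo q.\<close>

definition prime_character :: "nat \<Rightarrow> nat \<Rightarrow> nat \<Rightarrow> complex" where
  "prime_character q j n =
     (if q dvd n then 0 else cis (2 * pi / real (q - 1)) ^ (j * prime_index q n))"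

lemma cis_root_of_unity_power_eq_iff:
  assumes "M > 0"
  shows "cis (2 * pi / real M) ^ a = cis (2 * pi / real M) ^ b \<longleftrightarrow> [a = b] (mod M)"
proof -
  have "cis (2 * pi / real M) ^ a = cis (2 * pi / real M) ^ b
      \<longleftrightarrow> cis (real a * (2 * pi / real M) - real b * (2 * pi / real M)) = 1"
    by (simp add: Complex.DeMoivre flip: cis_divide)
  also have "real a * (2 * pi / real M) - real b * (2 * pi / real M)
      = real_of_int (int a - int b) / real M * (2 * pi)"
    using assms by (simp add: field_simps)
  also have "cis (real_of_int (int a - int b) / real M * (2 * pi)) = 1
      \<longleftrightarrow> (\<exists>n. real_of_int (int a - int b) / real M = real_of_int n)"
    unfolding cis_eq_1_iff by (intro arg_cong[where f = Ex] ext mult_right_cancel) simp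
  also have "\<dots> \<longleftrightarrow> (\<exists>n. real_of_int (int a - int b) = real_of_int (n * int M))"
    using assms by (simp add: divide_eq_eq)
  also have "\<dots> \<longleftrightarrow> (\<exists>n. int a - int b = n * int M)" by (simp only: of_int_eq_iff)
  also have "\<dots> \<longleftrightarrow> [int a = int b] (mod int M)"
    by (auto simp: cong_iff_dvd_diff dvd_def mult.commute)
  finally show ?thesis by (simp add: cong_int_iff)
qed

lemma prime_index_eq_iff:
  assumes "prime q" "\<not> q dvd m" "\<not> q dvd n"
  shows "[prime_index q m = prime_index q n] (mod (q - 1)) \<longleftrightarrow> [m = n] (mod q)"
proof -
  obtain g where g: "residue_primroot q g" "\<And>n. \<not> q dvd n \<Longrightarrow> [g ^ prime_index q n = n] (mod q)"
    using prime_index_primroot[OF assms(1)] by blast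
  have "[prime_index q m = prime_index q n] (mod (q - 1))
      \<longleftrightarrow> [g ^ prime_index q m = g ^ prime_index q n] (mod q)"
    using g(1) assms(1) by (subst order_divides_expdiff) (auto simp: residue_primroot_def totient_prime)
  also have "\<dots> \<longleftrightarrow> [m = n] (mod q)"
    using g(2)[OF assms(2)] g(2)[OF assms(3)] by (meson cong_sym cong_trans)
  finally show ?thesis .
qed

lemma prime_index_mult:
  assumes "prime q" "\<not> q dvd m" "\<not> q dvd n"
  shows "[prime_index q (m * n) = prime_index q m + prime_index q n] (mod (q - 1))"
proof -
  obtain g where g: "residue_primroot q g" "\<And>n. \<not> q dvd n \<Longrightarrow> [g ^ prime_index q n = n] (mod q)"
    using prime_index_primroot[OF assms(1)] by blast
  have "\<not> q dvd m * n" using assms by (simp add: prime_dvd_mult_iff)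
  from g(2)[OF this] have "[g ^ prime_index q (m * n) = m * n] (mod q)" .
  moreover have "[g ^ (prime_index q m + prime_index q n) = m * n] (mod q)"
    unfolding power_add by (intro cong_mult g assms)
  ultimately have "[g ^ prime_index q (m * n) = g ^ (prime_index q m + prime_index q n)] (mod q)"
    by (meson cong_sym cong_trans)
  then show ?thesis
    using g(1) assms(1) by (subst (asm) order_divides_expdiff) (auto simp: residue_primroot_def totient_prime)
qed

lemma dirichlet_character_prime_character:
  assumes q: "prime q"
  shows "dirichlet_character q (prime_character q j)"
proof
  have q1: "q > 1" using q prime_gt_1_nat by blast
  show "q > 0" using q1 by simp
  have cop: "coprime n q \<longleftrightarrow> \<not> q dvd n" for n
    using prime_imp_coprime[OF q] q1 by (metis coprime_absorb_left coprime_commute nat_dvd_1_iff_1 less_irrefl)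
  have power_cong: "cis (2 * pi / real (q - 1)) ^ (j * a) = cis (2 * pi / real (q - 1)) ^ (j * b)"
    if "[a = b] (mod (q - 1))" for a b
    using q1 that by (subst cis_root_of_unity_power_eq_iff) (auto intro: cong_scalar_left)
  show "prime_character q j (m * n) = prime_character q j m * prime_character q j n" for m n
  proof (cases "q dvd m \<or> q dvd n")
    case False
    then have nd: "\<not> q dvd m" "\<not> q dvd n" "\<not> q dvd m * n" using q by (auto simp: prime_dvd_mult_iff)
    show ?thesis
      using power_cong[OF prime_index_mult[OF q nd(1,2)]] nd
      by (simp add: prime_character_def distrib_left power_add)
  qed (auto simp: prime_character_def)
  show "prime_character q j (n + q) = prime_character q j n" for n
  proof (cases "q dvd n")
    case False
    then have "\<not> q dvd n + q" by simp
    from prime_index_eq_iff[OF q this False] have "[prime_index q (n + q) = prime_index q n] (mod (q - 1))"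
      by (simp add: cong_def)
    from power_cong[OF this] False show ?thesis by (simp add: prime_character_def)
  qed (simp add: prime_character_def)
  show "norm (prime_character q j n) = 1" if "coprime n q" for n
    using that by (simp add: cop prime_character_def norm_power)
  show "prime_character q j n = 0" if "\<not> coprime n q" for n
    using that by (simp add: cop prime_character_def)
qed

text \<open>For n prime to q the summand is z^j for a root of unity z of order dividing q - 1, and z
  = 1 exactly when n and a are congruent; a geometric sum decides both cases.\<close>

lemma prime_character_orthogonality:
  assumes q: "prime q" and a: "\<not> q dvd a"
  shows "(\<Sum>j<q - 1. cnj (prime_character q j a) * prime_character q j n)
    = (if [n = a] (mod q) then of_nat (q - 1) else 0)"
proof (cases "q dvd n")
  case True
  then have "\<not> [n = a] (mod q)" using a cong_dvd_iff by blast
  with True show ?thesis by (simp add: prime_character_def)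
next
  case False
  have M: "q - 1 > 0" using q prime_gt_1_nat by simp
  define w where "w = cis (2 * pi / real (q - 1))"
  define z where "z = cnj (w ^ prime_index q a) * w ^ prime_index q n"
  have w: "cnj w * w = 1" by (simp add: w_def mult.commute complex_norm_square[symmetric])
  have ww: "cnj (w ^ i) * w ^ i = 1" for i
    by (simp add: w flip: power_mult_distrib)
  have pc: "prime_character q j m = (w ^ prime_index q m) ^ j" if "\<not> q dvd m" for j m
    using that by (simp add: prime_character_def w_def mult.commute flip: power_mult)
  have term_eq: "cnj (prime_character q j a) * prime_character q j n = z ^ j" for j
    by (simp only: pc[OF a] pc[OF False] z_def power_mult_distrib complex_cnj_power)
  have "z = 1 \<longleftrightarrow> w ^ prime_index q n = w ^ prime_index q a"
  proof
    assume "z = 1"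
    then have "w ^ prime_index q a * (cnj (w ^ prime_index q a) * w ^ prime_index q n) = w ^ prime_index q a"
      by (simp add: z_def)
    then show "w ^ prime_index q n = w ^ prime_index q a"
      using ww[of "prime_index q a"] by (metis mult.assoc mult.commute mult_1)
  qed (use ww in \<open>simp add: z_def\<close>)
  also have "\<dots> \<longleftrightarrow> [n = a] (mod q)"
    unfolding w_def cis_root_of_unity_power_eq_iff[OF M] by (rule prime_index_eq_iff[OF q False a])
  finally have z1: "z = 1 \<longleftrightarrow> [n = a] (mod q)" .
  have "w ^ (q - 1) = 1"
    using cis_root_of_unity_power_eq_iff[OF M, of "q - 1" 0] by (simp add: w_def cong_def)
  then have "(w ^ i) ^ (q - 1) = 1" for i
    by (metis mult.commute power_mult power_one)
  then have "z ^ (q - 1) = 1"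
    by (simp only: z_def power_mult_distrib complex_cnj_power[symmetric]) simp
  then have "(\<Sum>j<q - 1. z ^ j) = (if z = 1 then of_nat (q - 1) else 0)"
    by (simp add: geometric_sum)
  then show ?thesis by (simp add: term_eq z1)
qed

section \<open>Characters modulo a product of distinct primes\<close>

definition product_character :: "nat set \<Rightarrow> (nat \<Rightarrow> nat) \<Rightarrow> nat \<Rightarrow> complex" where
  "product_character P k n = (\<Prod>q\<in>P. prime_character q (k q) n)"

lemma dvd_Prod:
  fixes P :: "nat set"
  assumes "finite P" "q \<in> P"
  shows "q dvd \<Prod>P"
  using dvd_prodI[OF assms, of "\<lambda>x. x"] by simp

lemma coprime_prod_primes_iff:
  fixes P :: "nat set"
  assumes P: "finite P" "\<forall>q\<in>P. prime q"
  shows "coprime n (\<Prod>P) \<longleftrightarrow> (\<forall>q\<in>P. \<not> q dvd n)"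
proof
  assume cop: "coprime n (\<Prod>P)"
  show "\<forall>q\<in>P. \<not> q dvd n"
  proof (intro ballI notI)
    fix q assume q: "q \<in> P" "q dvd n"
    with cop dvd_Prod[OF P(1) q(1)] have "is_unit q" by (meson coprime_common_divisor)
    with q P show False by auto
  qed
next
  assume "\<forall>q\<in>P. \<not> q dvd n"
  with P have "coprime n q" if "q \<in> P" for q
    using that prime_imp_coprime[of q n] by (simp add: coprime_commute)
  then show "coprime n (\<Prod>P)" by (intro prod_coprime_right)
qed

lemma dirichlet_character_product_character:
  assumes P: "finite P" "\<forall>q\<in>P. prime q"
  shows "dirichlet_character (\<Prod>P) (product_character P k)"
proof
  have ch: "dirichlet_character q (prime_character q j)" if "q \<in> P" for q j
    using P that dirichlet_character_prime_character by blast
  have cop: "coprime n q" if "coprime n (\<Prod>P)" "q \<in> P" for n q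
    using coprime_divisors[OF dvd_refl dvd_Prod[OF P(1) that(2)] that(1)] .
  show "\<Prod>P > 0" using P by (auto simp: prod_pos prime_gt_0_nat)
  show "product_character P k (m * n) = product_character P k m * product_character P k n" for m n
    unfolding product_character_def prod.distrib[symmetric]
    using dirichlet_character.mult[OF ch] by (intro prod.cong) auto
  show "product_character P k (n + \<Prod>P) = product_character P k n" for n
    unfolding product_character_def
  proof (rule prod.cong)
    fix q assume q: "q \<in> P"
    with P have "q dvd \<Prod>P" by (simp add: dvd_Prod)
    then have "(n + \<Prod>P) mod q = n mod q" by auto
    then show "prime_character q (k q) (n + \<Prod>P) = prime_character q (k q) n"
      by (metis dirichlet_character.mod_modulus[OF ch[OF q]])
  qed simp
  show "norm (product_character P k n) = 1" if "coprime n (\<Prod>P)" for n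
    unfolding product_character_def prod_norm[symmetric]
    using dirichlet_character.norm_eq_1[OF ch] cop[OF that] by (intro prod.neutral) blast
  show "product_character P k n = 0" if "\<not> coprime n (\<Prod>P)" for n
    using that P by (auto simp: coprime_prod_primes_iff product_character_def prime_character_def)
qed

text \<open>A sum over all choice functions k of a product over P is the product of the sums over
  each component, so the claim reduces to prime moduli, and the congruences recombine because the
  primes are pairwise coprime.\<close>

lemma product_character_orthogonality:
  assumes P: "finite P" "\<forall>q\<in>P. prime q" and a: "coprime a (\<Prod>P)"
  shows "(\<Sum>k\<in>PiE P (\<lambda>q. {..<q - 1}). cnj (product_character P k a) * product_character P k n)
    = (if [n = a] (mod \<Prod>P) then of_nat (\<Prod>q\<in>P. q - 1) else 0)"
proof -
  have "(\<Sum>k\<in>PiE P (\<lambda>q. {..<q - 1}). cnj (product_character P k a) * product_character P k n)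
      = (\<Sum>k\<in>PiE P (\<lambda>q. {..<q - 1}). \<Prod>q\<in>P. cnj (prime_character q (k q) a) * prime_character q (k q) n)"
    by (simp add: product_character_def prod.distrib)
  also have "\<dots> = (\<Prod>q\<in>P. \<Sum>j<q - 1. cnj (prime_character q j a) * prime_character q j n)"
    using P by (subst prod_sum_PiE) auto
  also have "\<dots> = (\<Prod>q\<in>P. if [n = a] (mod q) then of_nat (q - 1) else 0)"
    using P a by (intro prod.cong prime_character_orthogonality) (auto simp: coprime_prod_primes_iff)
  also have "\<dots> = (if [n = a] (mod \<Prod>P) then of_nat (\<Prod>q\<in>P. q - 1) else 0)"
  proof -
    have "[n = a] (mod \<Prod>P) \<longleftrightarrow> (\<forall>q\<in>P. [n = a] (mod q))"
    proof
      assume "[n = a] (mod \<Prod>P)"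
      then show "\<forall>q\<in>P. [n = a] (mod q)"
        by (auto intro: cong_dvd_modulus_nat[OF _ dvd_Prod[OF P(1)]])
    next
      assume "\<forall>q\<in>P. [n = a] (mod q)"
      then have "[n = a] (mod (\<Prod>q\<in>P. q))"
        using P by (intro coprime_cong_prod_nat) (auto simp: primes_coprime)
      then show "[n = a] (mod \<Prod>P)" by simp
    qed
    then show ?thesis using P by (auto simp: prod_zero)
  qed
  finally show ?thesis .
qed

text \<open>R may list more prime powers than B contains, since all terms are nonnegative. It can
  therefore be taken as a rectangle of bases and exponents, over which the sum is iterated.\<close>

lemma sum_mangoldt_le_prime_powers:
  assumes "finite B" "finite R"
    and R: "\<And>p i. (p, i) \<in> R \<Longrightarrow> prime p \<and> i > 0"
    and cover: "\<And>p i. prime p \<Longrightarrow> i > 0 \<Longrightarrow> p ^ i \<in> B \<Longrightarrow> (p, i) \<in> R"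
  shows "(\<Sum>n\<in>B. mangoldt n / real n) \<le> (\<Sum>(p,i)\<in>R. ln (real p) / real p ^ i)"
proof -
  let ?f = "\<lambda>(p::nat, i). p ^ i"
  have nn: "(mangoldt n :: real) / real n \<ge> 0" for n by (simp add: mangoldt_nonneg)
  have "(\<Sum>n\<in>B. mangoldt n / real n) = (\<Sum>n\<in>{n\<in>B. primepow n}. mangoldt n / real n)"
    using assms by (intro sum.mono_neutral_right) (auto simp: mangoldt_def)
  also have "\<dots> \<le> (\<Sum>n\<in>?f ` R. mangoldt n / real n)"
  proof (rule sum_mono2)
    show "{n\<in>B. primepow n} \<subseteq> ?f ` R"
    proof
      fix n assume n: "n \<in> {n\<in>B. primepow n}"
      then obtain p i where pi: "prime p" "i > 0" "n = p ^ i" by (auto simp: primepow_def)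
      with n cover[of p i] have "(p, i) \<in> R" by auto
      with pi show "n \<in> ?f ` R" by force
    qed
  qed (use assms nn in auto)
  also have "\<dots> \<le> (\<Sum>x\<in>R. mangoldt (?f x) / real (?f x))"
    using assms nn by (intro order.trans[OF sum_image_le]) auto
  also have "\<dots> = (\<Sum>(p,i)\<in>R. ln (real p) / real p ^ i)"
    using R by (intro sum.cong) (auto simp: mangoldt_primepow')
  finally show ?thesis .
qed

lemma geometric_inverse_sum_le:
  assumes "x \<ge> (2::real)"
  shows "(\<Sum>i=Suc m..N. 1 / x ^ i) \<le> 2 / x ^ Suc m"
proof -
  \<comment> \<open>The subtracted term strengthens the induction: it pays for the next summand
    because 2 / x \<le> 1.\<close>
  have "(\<Sum>i=Suc m..N. 1 / x ^ i) \<le> 2 / x ^ Suc m - 1 / x ^ N" if "N \<ge> Suc m"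
    using that
  proof (induction N rule: dec_induct)
    case (step N)
    have "1 / x ^ Suc N + 1 / x ^ Suc N \<le> 1 / x ^ N" using assms by (simp add: field_simps)
    with step show ?case by simp
  qed (use assms in simp)
  moreover have "1 / x ^ N \<ge> 0" "2 / x ^ Suc m \<ge> 0" using assms by auto
  ultimately show ?thesis
  proof (cases "N \<ge> Suc m")
    case False
    then have "(\<Sum>i=Suc m..N. 1 / x ^ i) = 0" by (intro sum.neutral) auto
    with \<open>2 / x ^ Suc m \<ge> 0\<close> show ?thesis by simp
  qed linarith
qed

lemma less_prime_power:
  fixes p :: nat
  assumes "prime p"
  shows "i < p ^ i"
  using power_gt_expt[of p i] prime_gt_1_nat[OF assms] by simp

text \<open>Only exponents from 2 on occur. For each p they contribute at most 2 ln p / p^2, and ln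
  p \<le> 2 sqrt p leaves 4 p^(-3/2), a convergent series.\<close>

lemma sum_mangoldt_nonprime_bounded:
  obtains C where "\<And>N. (\<Sum>n | n \<in> {1..N} \<and> \<not> prime n. mangoldt n / real n) \<le> C"
proof
  fix N :: nat
  let ?R = "{p\<in>{1..N}. prime p} \<times> {Suc 1..N}"
  have "(\<Sum>n | n \<in> {1..N} \<and> \<not> prime n. mangoldt n / real n) \<le> (\<Sum>(p,i)\<in>?R. ln (real p) / real p ^ i)"
  proof (rule sum_mangoldt_le_prime_powers)
    fix p i :: nat assume pi: "prime p" "i > 0" "p ^ i \<in> {n. n \<in> {1..N} \<and> \<not> prime n}"
    then have "i \<noteq> 1" by auto
    moreover have "i < p ^ i" using pi less_prime_power by blast
    moreover have "p \<le> p ^ i" using pi prime_gt_0_nat by (intro self_le_power) (auto simp: Suc_leI)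
    ultimately show "(p, i) \<in> ?R" using pi prime_gt_0_nat[of p] by auto
  qed auto
  also have "\<dots> = (\<Sum>p | p \<in> {1..N} \<and> prime p. ln (real p) * (\<Sum>i=Suc 1..N. 1 / real p ^ i))"
    by (subst sum.cartesian_product[symmetric]) (simp add: sum_distrib_left)
  also have "\<dots> \<le> (\<Sum>p | p \<in> {1..N} \<and> prime p. 4 * real p powr (-3/2))"
  proof (rule sum_mono)
    fix p assume "p \<in> {p. p \<in> {1..N} \<and> prime p}"
    then have p: "real p \<ge> 2" using prime_ge_2_nat[of p] by auto
    have "ln (real p) * (\<Sum>i=Suc 1..N. 1 / real p ^ i) \<le> (real p powr (1/2) / (1/2)) * (2 / real p ^ Suc 1)"
      using p by (intro mult_mono ln_powr_bound geometric_inverse_sum_le sum_nonneg) auto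
    also have "\<dots> = 4 * (real p powr (1/2) / real p powr 2)"
      using p by (simp add: powr_numeral power2_eq_square)
    also have "\<dots> = 4 * real p powr (1/2 - 2)" by (simp only: powr_diff)
    also have "\<dots> = 4 * real p powr (-3/2)" by simp
    finally show "ln (real p) * (\<Sum>i=Suc 1..N. 1 / real p ^ i) \<le> 4 * real p powr (-3/2)" .
  qed
  also have "\<dots> \<le> (\<Sum>p. 4 * real p powr (-3/2))"
  proof (rule sum_le_suminf)
    show "summable (\<lambda>p. 4 * real p powr (-3/2))"
      using summable_real_powr_iff[of "-3/2"] by (intro summable_mult) auto
  qed auto
  finally show "(\<Sum>n | n \<in> {1..N} \<and> \<not> prime n. mangoldt n / real n) \<le> (\<Sum>p. 4 * real p powr (-3/2))" .
qed

lemma sum_mangoldt_not_coprime_bounded: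
  assumes P: "finite P" "\<forall>q\<in>P. prime q"
  shows "(\<Sum>n | n \<in> {1..N} \<and> \<not> coprime n (\<Prod>P). mangoldt n / real n) \<le> (\<Sum>q\<in>P. ln (real q))"
proof -
  have "(\<Sum>n | n \<in> {1..N} \<and> \<not> coprime n (\<Prod>P). mangoldt n / real n)
      \<le> (\<Sum>(p,i)\<in>P \<times> {Suc 0..N}. ln (real p) / real p ^ i)"
  proof (rule sum_mangoldt_le_prime_powers)
    fix p i :: nat assume pi: "prime p" "i > 0" "p ^ i \<in> {n. n \<in> {1..N} \<and> \<not> coprime n (\<Prod>P)}"
    then obtain q where q: "q \<in> P" "q dvd p ^ i" using P by (auto simp: coprime_prod_primes_iff)
    with P pi have "q = p" by (metis prime_dvd_power primes_dvd_imp_eq)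
    moreover have "i < p ^ i" using pi less_prime_power by blast
    ultimately show "(p, i) \<in> P \<times> {Suc 0..N}" using pi q by auto
  qed (use P in auto)
  also have "\<dots> = (\<Sum>p\<in>P. ln (real p) * (\<Sum>i=Suc 0..N. 1 / real p ^ i))"
    by (subst sum.cartesian_product[symmetric]) (simp add: sum_distrib_left)
  also have "\<dots> \<le> (\<Sum>p\<in>P. ln (real p) * 1)"
  proof (intro sum_mono mult_left_mono)
    fix p assume "p \<in> P"
    then have p: "real p \<ge> 2" using P prime_ge_2_nat[of p] by auto
    have "(\<Sum>i=Suc 0..N. 1 / real p ^ i) \<le> 2 / real p ^ Suc 0" using p by (rule geometric_inverse_sum_le)
    also have "\<dots> \<le> 1" using p by simp
    finally show "(\<Sum>i=Suc 0..N. 1 / real p ^ i) \<le> 1" .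
    show "ln (real p) \<ge> 0" using p by simp
  qed
  finally show ?thesis by simp
qed

text \<open>For a nonprincipal character the sum is bounded since \<open>L_one\<close> is nonzero;
  for the principal one it has nonnegative terms. A common lower bound lets a whole family of
  characters be treated without deciding which of them are principal.\<close>

lemma (in dirichlet_character) Re_mangoldt_sum_bounded_below:
  assumes "coprime a L"
  obtains C where "\<And>N. Re (cnj (\<psi> a) * mangoldt_sum N) \<ge> C"
proof (cases "\<exists>m. coprime m L \<and> \<psi> m \<noteq> 1")
  case True
  then interpret nonprincipal_character by unfold_locales
  obtain C where C: "\<And>N. norm (mangoldt_sum N) \<le> C"
    using bounded_mangoldt_sum[OF L_one_neq_0] by blast
  have "Re (cnj (\<psi> a) * mangoldt_sum N) \<ge> - C" for N
  proof -
    have "norm (cnj (\<psi> a) * mangoldt_sum N) \<le> C"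
      using C assms by (simp add: norm_mult norm_eq_1)
    then show ?thesis using abs_Re_le_cmod[of "cnj (\<psi> a) * mangoldt_sum N"] by linarith
  qed
  then show ?thesis by (rule that)
next
  case False
  then have val: "\<psi> n = (if coprime n L then 1 else 0)" for n using eq_zero by auto
  have "Re (cnj (\<psi> a) * mangoldt_sum N) \<ge> 0" for N
    using assms by (auto simp: val mangoldt_sum_def Re_divide_of_nat mangoldt_nonneg intro!: sum_nonneg)
  then show ?thesis by (rule that)
qed

lemma product_character_zero:
  fixes P :: "nat set"
  assumes "finite P" "\<forall>q\<in>P. prime q"
  shows "product_character P (\<lambda>q\<in>P. 0) n = (if coprime n (\<Prod>P) then 1 else 0)"
  using assms by (auto simp: product_character_def prime_character_def coprime_prod_primes_iff)

text \<open>Only products of distinct primes are needed as moduli, so primitive roots suffice to construct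
  all characters.\<close>

theorem dirichlet_squarefree:
  fixes P :: "nat set" and a :: nat
  assumes P: "finite P" "\<forall>q\<in>P. prime q" and a: "coprime a (\<Prod>P)"
  shows "infinite {p. prime p \<and> [p = a] (mod \<Prod>P)}"
proof
  assume fin: "finite {p. prime p \<and> [p = a] (mod \<Prod>P)}"
  define K where "K = PiE P (\<lambda>q. {..<q - 1})"
  define M where "M = (\<Prod>q\<in>P. q - 1)"
  define X where "X k = product_character P k" for k
  define S where "S k = dirichlet_character.mangoldt_sum (X k)" for k
  have ch: "dirichlet_character (\<Prod>P) (X k)" for k
    unfolding X_def using P by (rule dirichlet_character_product_character)
  have S: "S k N = (\<Sum>n=1..N. X k n * mangoldt n / of_nat n)" for k N
    unfolding S_def by (rule dirichlet_character.mangoldt_sum_def[OF ch])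
  \<comment> \<open>This choice gives the principal character; the restriction to P makes it a
    member of the extensional function space \<open>K\<close>.\<close>
  let ?k0 = "\<lambda>q\<in>P. 0::nat"
  have finK: "finite K" unfolding K_def using P by (intro finite_PiE) auto
  have k0: "?k0 \<in> K" using P prime_gt_1_nat by (auto simp: K_def)
  have "\<exists>C. \<forall>N. Re (cnj (X k a) * S k N) \<ge> C" for k
    using dirichlet_character.Re_mangoldt_sum_bounded_below[OF ch a] unfolding S_def by metis
  then obtain C where C: "\<And>k N. Re (cnj (X k a) * S k N) \<ge> C k" by metis
  obtain D where D: "\<And>N. (\<Sum>n | n \<in> {1..N} \<and> \<not> prime n. mangoldt n / real n) \<le> D"
    using sum_mangoldt_nonprime_bounded by blast
  define E where "E = (\<Sum>p | prime p \<and> [p = a] (mod \<Prod>P). mangoldt p / real p)"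
  \<comment> \<open>The constant collects the upper bound for the residue class, the lower bounds of
    the other characters, the 1 of \<open>mertens_lower\<close>, and the loss from indices sharing a
    factor with the modulus.\<close>
  define B where "B = real M * (E + D) - sum C (K - {?k0}) + 1 + (\<Sum>q\<in>P. ln (real q))"
  have nn: "(mangoldt n :: real) / real n \<ge> 0" for n by (simp add: mangoldt_nonneg)
  have "ln (real N) \<le> B" if N: "N > 0" for N
  proof -
    have "(\<Sum>k\<in>K. cnj (X k a) * S k N)
        = (\<Sum>n=1..N. (\<Sum>k\<in>K. cnj (X k a) * X k n) * (mangoldt n / of_nat n))"
      unfolding S sum_distrib_left sum_distrib_right by (subst sum.swap) (simp add: mult.assoc)
    also have "\<dots> = (\<Sum>n=1..N. if [n = a] (mod \<Prod>P) then of_nat M * (mangoldt n / of_nat n) else 0)"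
      unfolding K_def X_def M_def product_character_orthogonality[OF P a] by (intro sum.cong) auto
    also have "\<dots> = of_real (real M * (\<Sum>n | n \<in> {1..N} \<and> [n = a] (mod \<Prod>P). mangoldt n / real n))"
      by (simp add: sum.If_cases sum_distrib_left Int_def)
    finally have orth: "(\<Sum>k\<in>K. Re (cnj (X k a) * S k N))
        = real M * (\<Sum>n | n \<in> {1..N} \<and> [n = a] (mod \<Prod>P). mangoldt n / real n)"
      by (simp only: Re_sum[symmetric] Re_complex_of_real)
    \<comment> \<open>Under the assumption to be refuted, an index in the class is one of finitely
      many primes or not prime at all, so the sum is bounded independently of N.\<close>
    have "(\<Sum>n | n \<in> {1..N} \<and> [n = a] (mod \<Prod>P). mangoldt n / real n)
        \<le> (\<Sum>n\<in>{p. prime p \<and> [p = a] (mod \<Prod>P)} \<union> {n. n \<in> {1..N} \<and> \<not> prime n}. mangoldt n / real n)"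
      using fin nn by (intro sum_mono2) auto
    also have "\<dots> = E + (\<Sum>n | n \<in> {1..N} \<and> \<not> prime n. mangoldt n / real n)"
      unfolding E_def using fin by (intro sum.union_disjoint) auto
    also have "\<dots> \<le> E + D" using D by simp
    finally have upper: "(\<Sum>k\<in>K. Re (cnj (X k a) * S k N)) \<le> real M * (E + D)"
      unfolding orth by (rule mult_left_mono) simp
    have "(\<Sum>n=1..N. mangoldt n / real n)
        = (\<Sum>n | n \<in> {1..N} \<and> coprime n (\<Prod>P). mangoldt n / real n)
        + (\<Sum>n | n \<in> {1..N} \<and> \<not> coprime n (\<Prod>P). mangoldt n / real n)"
      by (subst sum.union_disjoint[symmetric]) (auto intro!: sum.cong)
    then have "(\<Sum>n | n \<in> {1..N} \<and> coprime n (\<Prod>P). mangoldt n / real n)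
        \<ge> ln (real N) - 1 - (\<Sum>q\<in>P. ln (real q))"
      using mertens_lower[OF N] sum_mangoldt_not_coprime_bounded[OF P, of N] by linarith
    also have "(\<Sum>n | n \<in> {1..N} \<and> coprime n (\<Prod>P). mangoldt n / real n) = Re (cnj (X ?k0 a) * S ?k0 N)"
    proof -
      have "cnj (X ?k0 a) * S ?k0 N = (\<Sum>n=1..N. if coprime n (\<Prod>P) then mangoldt n / of_nat n else 0)"
        unfolding S X_def product_character_zero[OF P] using a by (auto intro!: sum.cong)
      also have "\<dots> = of_real (\<Sum>n | n \<in> {1..N} \<and> coprime n (\<Prod>P). mangoldt n / real n)"
        by (simp add: sum.If_cases Int_def)
      finally show ?thesis by (simp only: Re_complex_of_real)
    qed
    finally have "Re (cnj (X ?k0 a) * S ?k0 N) \<ge> ln (real N) - 1 - (\<Sum>q\<in>P. ln (real q))" .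
    moreover have "(\<Sum>k\<in>K - {?k0}. Re (cnj (X k a) * S k N)) \<ge> sum C (K - {?k0})"
      by (intro sum_mono C)
    moreover have "(\<Sum>k\<in>K. Re (cnj (X k a) * S k N))
        = Re (cnj (X ?k0 a) * S ?k0 N) + (\<Sum>k\<in>K - {?k0}. Re (cnj (X k a) * S k N))"
      using finK k0 by (rule sum.remove)
    ultimately show ?thesis using upper by (simp add: B_def)
  qed
  moreover have "filterlim (\<lambda>N. ln (real N)) at_top sequentially" by real_asymp
  ultimately show False
    by (auto simp: filterlim_at_top_dense eventually_sequentially dest!: spec[of _ B])
       (meson max.cobounded1 max.cobounded2 less_le_not_le zero_less_Suc order_less_le_trans)
qed

section \<open>Normality of dilated rectangular simplices\<close>

text \<open>The linear functional with value 1 at every nonzero vertex of the simplex; on points of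
  the orthant it tells which dilations contain them.\<close>

definition weight :: "('n::finite \<Rightarrow> nat) \<Rightarrow> ('n \<Rightarrow> nat) \<Rightarrow> real" where
  "weight a z = (\<Sum>i\<in>UNIV. real (z i) / real (a i))"

definition nat_vec :: "('n::finite \<Rightarrow> nat) \<Rightarrow> real ^ 'n" where
  "nat_vec z = (\<chi> i. real (z i))"

lemma nat_vec_nth [simp]: "nat_vec z $ i = real (z i)"
  by (simp add: nat_vec_def)

lemma mem_rect_simplex:
  assumes a: "\<And>i. a i \<ge> 1"
  shows "x \<in> rect_simplex a \<longleftrightarrow> (\<forall>i. x $ i \<ge> 0) \<and> (\<Sum>i\<in>UNIV. x $ i / real (a i)) \<le> 1"
proof -
  let ?V = "insert 0 (range (\<lambda>i. real (a i) *\<^sub>R axis i 1)) :: (real ^ 'a) set"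
  let ?H = "{x :: real ^ 'a. (\<forall>i. x $ i \<ge> 0) \<and> (\<Sum>i\<in>UNIV. x $ i / real (a i)) \<le> 1}"
  have a0: "real (a i) > 0" for i using a[of i] by simp
  have "convex hull ?V \<subseteq> ?H"
  proof (rule hull_minimal)
    show "?V \<subseteq> ?H"
    proof
      fix v assume "v \<in> ?V"
      then consider "v = 0" | j where "v = real (a j) *\<^sub>R axis j 1" by auto
      then show "v \<in> ?H"
      proof cases
        case 2
        have "(\<Sum>i\<in>UNIV. v $ i / real (a i)) = (\<Sum>i\<in>UNIV. if i = j then 1 else 0)"
          using a0 by (intro sum.cong) (auto simp: 2 axis_def less_imp_neq[symmetric])
        then show ?thesis by (auto simp: 2 axis_def)
      qed simp
    qed
    show "convex ?H"
    proof (rule convexI)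
      fix x y :: "real ^ 'a" and u v :: real
      assume xy: "x \<in> ?H" "y \<in> ?H" and uv: "u \<ge> 0" "v \<ge> 0" "u + v = 1"
      have "(\<Sum>i\<in>UNIV. (u *\<^sub>R x + v *\<^sub>R y) $ i / real (a i))
          = u * (\<Sum>i\<in>UNIV. x $ i / real (a i)) + v * (\<Sum>i\<in>UNIV. y $ i / real (a i))"
        by (simp add: sum_distrib_left sum.distrib add_divide_distrib)
      also have "\<dots> \<le> u * 1 + v * 1"
        using xy uv by (intro add_mono mult_left_mono) auto
      finally show "u *\<^sub>R x + v *\<^sub>R y \<in> ?H" using xy uv by auto
    qed
  qed
  moreover have "x \<in> convex hull ?V" if x: "x \<in> ?H" for x
  proof -
    define s where "s = (\<Sum>i\<in>UNIV. x $ i / real (a i))"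
    have nn: "x $ i / real (a i) \<ge> 0" for i using x a0[of i] by auto
    have rep: "x = (\<Sum>i\<in>UNIV. (x $ i / real (a i)) *\<^sub>R (real (a i) *\<^sub>R axis i 1))"
      using a0 by (simp add: vec_eq_iff axis_def if_distrib less_imp_neq[symmetric] cong: if_cong)
    show ?thesis
    proof (cases "s = 0")
      case True
      then have "x $ i / real (a i) = 0" for i
        unfolding s_def using nn by (subst (asm) sum_nonneg_eq_0_iff) auto
      then have "x = 0" using a0 by (simp add: vec_eq_iff less_imp_neq[symmetric])
      then show ?thesis by (simp add: hull_inc)
    next
      case False
      then have s: "s > 0" "s \<le> 1" using x nn sum_nonneg[of UNIV "\<lambda>i. x $ i / real (a i)"] by (auto simp: s_def)
      \<comment> \<open>This is x / s, on the facet opposite the origin; x lies on the segment from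
        the origin to it.\<close>
      let ?y = "\<Sum>i\<in>UNIV. (x $ i / real (a i) / s) *\<^sub>R (real (a i) *\<^sub>R axis i 1) :: real ^ 'a"
      have "?y \<in> convex hull ?V"
      proof (rule convex_sum)
        show "(\<Sum>i\<in>UNIV. x $ i / real (a i) / s) = 1"
          using s unfolding sum_divide_distrib[symmetric] s_def[symmetric] by simp
        show "x $ i / real (a i) / s \<ge> 0" for i using divide_nonneg_pos[OF nn[of i] s(1)] .
      qed (auto intro: hull_inc simp: convex_convex_hull)
      then have "s *\<^sub>R ?y + (1 - s) *\<^sub>R 0 \<in> convex hull ?V"
        using s by (intro convexD[OF convex_convex_hull]) (auto intro: hull_inc)
      also have "s *\<^sub>R ?y + (1 - s) *\<^sub>R 0
          = (\<Sum>i\<in>UNIV. (x $ i / real (a i)) *\<^sub>R (real (a i) *\<^sub>R axis i 1))"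
        using s by (simp only: scaleR_sum_right scaleR_zero_right add_0_right) (intro sum.cong, auto)
      also have "\<dots> = x" by (rule rep[symmetric])
      finally show ?thesis .
    qed
  qed
  ultimately show ?thesis unfolding rect_simplex_def by blast
qed

lemma mem_dilate_rect_simplex:
  assumes a: "\<And>i. a i \<ge> 1" and k: "k \<ge> 1"
  shows "x \<in> dilate k (rect_simplex a) \<longleftrightarrow>
    (\<forall>i. x $ i \<ge> 0) \<and> (\<Sum>i\<in>UNIV. x $ i / real (a i)) \<le> real k"
proof -
  have "x \<in> dilate k (rect_simplex a) \<longleftrightarrow> (1 / real k) *\<^sub>R x \<in> rect_simplex a"
  proof
    assume "(1 / real k) *\<^sub>R x \<in> rect_simplex a"
    then show "x \<in> dilate k (rect_simplex a)"
      using k unfolding dilate_def by (intro image_eqI[of _ _ "(1 / real k) *\<^sub>R x"]) auto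
  qed (use k in \<open>auto simp: dilate_def\<close>)
  also have "\<dots> \<longleftrightarrow> (\<forall>i. x $ i \<ge> 0) \<and> (\<Sum>i\<in>UNIV. x $ i / real (a i)) / real k \<le> 1"
    using k by (simp add: mem_rect_simplex[OF a] sum_divide_distrib mult.commute zero_le_divide_iff)
  finally show ?thesis using k by (simp add: field_simps)
qed

lemma dilate_dilate: "dilate m (dilate k Q) = dilate (m * k) Q"
  by (simp add: dilate_def image_image)

lemma lattice_polytope_dilate_rect_simplex: "lattice_polytope (dilate k (rect_simplex a))"
  unfolding lattice_polytope_def
proof (intro exI conjI)
  let ?V = "insert 0 (range (\<lambda>i. real (a i) *\<^sub>R axis i 1)) :: (real ^ 'a) set"
  show "finite ((\<lambda>x. real k *\<^sub>R x) ` ?V)" by simp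
  show "(\<lambda>x. real k *\<^sub>R x) ` ?V \<subseteq> int_lattice" by (auto simp: int_lattice_def axis_def)
  show "dilate k (rect_simplex a) = convex hull ((\<lambda>x. real k *\<^sub>R x) ` ?V)"
    by (simp only: dilate_def rect_simplex_def convex_hull_scaling)
qed

lemma nat_vec_in_int_lattice [simp]: "nat_vec z \<in> int_lattice"
  by (simp add: int_lattice_def)

lemma nat_vec_in_dilate_iff:
  assumes "\<And>i. a i \<ge> 1" "k \<ge> 1"
  shows "nat_vec z \<in> dilate k (rect_simplex a) \<longleftrightarrow> weight a z \<le> real k"
  using assms by (simp add: mem_dilate_rect_simplex weight_def)

lemma int_lattice_dilate_obtain:
  assumes "\<And>i. a i \<ge> 1" "k \<ge> 1" "x \<in> dilate k (rect_simplex a) \<inter> int_lattice"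
  obtains z where "x = nat_vec z" "weight a z \<le> real k"
proof -
  have x: "\<And>i. x $ i \<ge> 0" "\<And>i. x $ i \<in> \<int>"
    using assms by (auto simp: mem_dilate_rect_simplex int_lattice_def)
  have "\<exists>n. x $ i = real n" for i
    using x(1)[of i] x(2)[of i] by (metis Nats_cases Nats_altdef2 mem_Collect_eq)
  then obtain z where "\<And>i. x $ i = real (z i)" by metis
  then have z: "x = nat_vec z" by (simp add: vec_eq_iff)
  with assms have "weight a z \<le> real k" by (simp add: nat_vec_in_dilate_iff)
  with z show ?thesis by (rule that)
qed

lemma weight_add: "weight a (\<lambda>i. y i + z i) = weight a y + weight a z"
  by (simp add: weight_def add_divide_distrib sum.distrib)

lemma weight_diff:
  assumes "\<And>i. y i \<le> z i"
  shows "weight a (\<lambda>i. z i - y i) = weight a z - weight a y"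
  using assms by (simp add: weight_def of_nat_diff diff_divide_distrib sum_subtractf)

lemma weight_single: "weight a (\<lambda>i. if i = j then c else 0) = real c / real (a j)"
proof -
  have "weight a (\<lambda>i. if i = j then c else 0) = (\<Sum>i\<in>UNIV. if i = j then real c / real (a i) else 0)"
    unfolding weight_def by (intro sum.cong) auto
  then show ?thesis by simp
qed

text \<open>If some coordinate reaches a i, a vertex of weight exactly 1 can be removed. Otherwise
  every coordinate contributes less than 1, and deleting any one of them leaves at most n - 1 \<le>
  h.\<close>

lemma split_off_unit_weight:
  fixes a z :: "'n::finite \<Rightarrow> nat"
  assumes a: "\<And>i. a i \<ge> 1" and h: "Suc h \<ge> CARD('n)" and z: "weight a z \<le> real (Suc h)"
  shows "\<exists>y. (\<forall>i. y i \<le> z i) \<and> weight a y \<le> 1 \<and> weight a (\<lambda>i. z i - y i) \<le> real h"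
proof (cases "\<exists>i. z i \<ge> a i")
  case True
  then obtain j where j: "z j \<ge> a j" by blast
  let ?y = "\<lambda>i. if i = j then a j else 0"
  have y: "\<And>i. ?y i \<le> z i" using j by auto
  have "weight a ?y = 1" using a[of j] by (simp add: weight_single)
  with y z weight_diff[of ?y z a, OF y] show ?thesis by (intro exI[of _ ?y]) auto
next
  case False
  then have lt: "z i < a i" for i by (simp add: not_le)
  obtain j :: 'n where True by blast
  let ?y = "\<lambda>i. if i = j then z j else 0"
  have y: "\<And>i. ?y i \<le> z i" by auto
  have "weight a ?y \<le> 1" using lt[of j] a[of j] by (simp add: weight_single)
  moreover have "weight a (\<lambda>i. z i - ?y i) \<le> real h"
  proof -
    have "weight a (\<lambda>i. z i - ?y i) = (\<Sum>i\<in>UNIV - {j}. real (z i - ?y i) / real (a i))"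
      unfolding weight_def by (intro sum.mono_neutral_right) auto
    also have "\<dots> \<le> (\<Sum>i\<in>UNIV - {j}. 1)"
      using lt a by (intro sum_mono) (auto simp: divide_le_eq_1 less_imp_le)
    also have "\<dots> = real (CARD('n) - 1)" by simp
    also have "\<dots> \<le> real h" using h by simp
    finally show ?thesis .
  qed
  ultimately show ?thesis using y by (intro exI[of _ ?y]) auto
qed

text \<open>Unit pieces are removed k times and accumulated in y. The threshold for a unit step
  holds throughout, because the bound on the remainder never drops below h.\<close>

lemma split_off_weight:
  fixes a z :: "'n::finite \<Rightarrow> nat"
  assumes a: "\<And>i. a i \<ge> 1" and h: "Suc h \<ge> CARD('n)" and z: "weight a z \<le> real (h + k)"
  shows "\<exists>y. (\<forall>i. y i \<le> z i) \<and> weight a y \<le> real k \<and> weight a (\<lambda>i. z i - y i) \<le> real h"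
  using z
proof (induction k arbitrary: z)
  case 0
  then show ?case by (intro exI[of _ "\<lambda>_. 0"]) (auto simp: weight_def)
next
  case (Suc k)
  obtain y where y: "\<And>i. y i \<le> z i" "weight a y \<le> 1" "weight a (\<lambda>i. z i - y i) \<le> real (h + k)"
    using split_off_unit_weight[of a "h + k" z] a h Suc.prems by auto
  from Suc.IH[OF y(3)] obtain y' where y': "\<And>i. y' i \<le> z i - y i" "weight a y' \<le> real k"
    "weight a (\<lambda>i. z i - y i - y' i) \<le> real h" by blast
  have "y i + y' i \<le> z i" for i using y(1)[of i] y'(1)[of i] by linarith
  moreover have "weight a (\<lambda>i. y i + y' i) \<le> real (Suc k)" using y y' by (simp add: weight_add)
  ultimately show ?case using y'(3) by (intro exI[of _ "\<lambda>i. y i + y' i"]) (auto simp: diff_diff_add)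
qed

lemma weight_decomposition:
  fixes a z :: "'n::finite \<Rightarrow> nat"
  assumes a: "\<And>i. a i \<ge> 1" and k: "Suc k \<ge> CARD('n)" and z: "weight a z \<le> real (Suc m * k)"
  shows "\<exists>Y. (\<forall>j<Suc m. weight a (Y j) \<le> real k) \<and> (\<forall>i. z i = (\<Sum>j<Suc m. Y j i))"
  using z
proof (induction m arbitrary: z)
  case 0
  then show ?case by (intro exI[of _ "\<lambda>_. z"]) auto
next
  case (Suc m)
  have "Suc (Suc m * k) \<ge> CARD('n)" using k by simp
  from split_off_weight[of a, OF a this, of z k] Suc.prems
  obtain y where y: "\<And>i. y i \<le> z i" "weight a y \<le> real k" "weight a (\<lambda>i. z i - y i) \<le> real (Suc m * k)"
    by (auto simp: algebra_simps)
  from Suc.IH[OF y(3)] obtain Y where Y: "\<And>j. j < Suc m \<Longrightarrow> weight a (Y j) \<le> real k"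
    "\<And>i. z i - y i = (\<Sum>j<Suc m. Y j i)" by blast
  have "z i = (\<Sum>j<Suc (Suc m). (Y(Suc m := y)) j i)" for i
  proof -
    have "(\<Sum>j<Suc m. (Y(Suc m := y)) j i) = (\<Sum>j<Suc m. Y j i)" by (intro sum.cong) auto
    then show ?thesis using Y(2)[of i] y(1)[of i] by simp
  qed
  moreover have "weight a ((Y(Suc m := y)) j) \<le> real k" if "j < Suc (Suc m)" for j
    using that Y(1) y(2) by (cases "j = Suc m") auto
  ultimately show ?case by blast
qed

lemma normal_dilate_rect_simplex:
  fixes a :: "'n::finite \<Rightarrow> nat"
  assumes a: "\<And>i. a i \<ge> 1" and k: "k \<ge> 1" "Suc k \<ge> CARD('n)"
  shows "normal_polytope (dilate k (rect_simplex a))"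
  unfolding normal_polytope_def
proof (intro conjI allI impI ballI lattice_polytope_dilate_rect_simplex)
  fix m :: nat and x :: "real ^ 'n"
  assume m: "m \<ge> 1" and x: "x \<in> dilate m (dilate k (rect_simplex a)) \<inter> int_lattice"
  have "m * k \<ge> 1" using m k by simp
  then obtain z where z: "x = nat_vec z" "weight a z \<le> real (m * k)"
    using int_lattice_dilate_obtain[of a "m * k" x, OF a] x unfolding dilate_dilate by blast
  obtain m' where m': "m = Suc m'" using m by (cases m) auto
  obtain Y where Y: "\<And>j. j < m \<Longrightarrow> weight a (Y j) \<le> real k" "\<And>i. z i = (\<Sum>j<m. Y j i)"
    using weight_decomposition[of a k z m', OF a k(2)] z(2) unfolding m' by blast
  have "\<forall>j<m. nat_vec (Y j) \<in> dilate k (rect_simplex a) \<inter> int_lattice"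
    using Y(1) nat_vec_in_dilate_iff[of a k, OF a k(1)] by simp
  moreover have "x = (\<Sum>j<m. nat_vec (Y j))"
    by (simp add: z(1) vec_eq_iff Y(2))
  ultimately show "\<exists>y. (\<forall>j<m. y j \<in> dilate k (rect_simplex a) \<inter> int_lattice) \<and> x = (\<Sum>j<m. y j)"
    by (intro exI[of _ "\<lambda>j. nat_vec (Y j)"]) auto
qed

section \<open>Failure of normality for the dilation by n - 2\<close>

lemma weight_times_prod:
  fixes a z :: "'n::finite \<Rightarrow> nat"
  assumes a: "\<And>i. a i \<ge> 1"
  shows "weight a z * real (prod a UNIV) = real (\<Sum>i\<in>UNIV. z i * prod a (UNIV - {i}))"
proof -
  have "real (z i) / real (a i) * real (prod a UNIV) = real (z i * prod a (UNIV - {i}))" for i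
    using a[of i] prod.remove[of UNIV i a] by simp
  then show ?thesis unfolding weight_def sum_distrib_right by simp
qed

text \<open>After clearing denominators every term but the i-th vanishes modulo a i, and the
  cofactor of z i, a product of the other parameters, is coprime to a i.\<close>

lemma dvd_of_integral_weight:
  fixes a z :: "'n::finite \<Rightarrow> nat"
  assumes a: "\<And>i. a i \<ge> 1" and cop: "\<And>i j. i \<noteq> j \<Longrightarrow> coprime (a i) (a j)"
    and z: "weight a z = real c"
  shows "a i dvd z i"
proof -
  have "real c * real (prod a UNIV) = real (\<Sum>i\<in>UNIV. z i * prod a (UNIV - {i}))"
    using weight_times_prod[of a z, OF a] z by simp
  then have eq: "c * prod a UNIV = (\<Sum>i\<in>UNIV. z i * prod a (UNIV - {i}))"
    by (metis of_nat_eq_iff of_nat_mult)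
  also have "\<dots> = z i * prod a (UNIV - {i}) + (\<Sum>j\<in>UNIV - {i}. z j * prod a (UNIV - {j}))"
    by (rule sum.remove) auto
  finally have eq: "c * prod a UNIV = \<dots>" .
  have "a i dvd c * prod a UNIV" by (simp add: dvd_prodI)
  moreover have "a i dvd (\<Sum>j\<in>UNIV - {i}. z j * prod a (UNIV - {j}))"
    by (intro dvd_sum dvd_mult dvd_prodI) auto
  ultimately have "a i dvd z i * prod a (UNIV - {i})"
    unfolding eq by (simp add: dvd_add_left_iff)
  moreover have "coprime (a i) (prod a (UNIV - {i}))" by (intro prod_coprime_right cop) auto
  ultimately show ?thesis by (simp add: coprime_dvd_mult_left_iff)
qed

text \<open>The obstruction is a lattice point of \<open>(n - 1) \<Delta>\<close>, inside the half-open box spanned by the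
  edges, whose weight misses \<open>n - 1\<close> by the least possible amount.  After adding \<open>n - 3\<close> copies of a
  vertex, one of two summands would have integral weight \<open>n - 2\<close>, hence be a sum of \<open>n - 2\<close>
  vertices, but only \<open>n - 3\<close> of them fit.\<close>

lemma not_normal_dilate_rect_simplex:
  fixes a x :: "'n::finite \<Rightarrow> nat"
  assumes a: "\<And>i. a i \<ge> 1" and n: "CARD('n) \<ge> 3"
    and cop: "\<And>i j. i \<noteq> j \<Longrightarrow> coprime (a i) (a j)"
    and lt: "\<And>i. x i < a i"
    and x: "weight a x = real (CARD('n) - 1) - 1 / real (prod a UNIV)"
  shows "\<not> normal_polytope (dilate (CARD('n) - 2) (rect_simplex a))"
proof
  assume normal: "normal_polytope (dilate (CARD('n) - 2) (rect_simplex a))"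
  define k where "k = CARD('n) - 2"
  define W where "W = prod a UNIV"
  have k: "k \<ge> 1" "CARD('n) = k + 2" using n by (auto simp: k_def)
  have W: "W > 0" unfolding W_def using a by (intro prod_pos) (auto simp: Suc_le_eq)
  obtain l :: 'n where True by blast
  \<comment> \<open>The weight rises by k - 1 to 2 * k - 1 / W, just inside the doubled polytope,
    while direction \<open>l\<close> still has room for fewer than k copies of its vertex.\<close>
  define v where "v i = x i + (if i = l then (k - 1) * a l else 0)" for i
  have "weight a v = weight a x + real ((k - 1) * a l) / real (a l)"
    unfolding v_def weight_add weight_single ..
  also have "\<dots> = real (k + 1) - 1 / real W + real (k - 1)"
    using a[of l] by (simp add: x k W_def)
  finally have v: "weight a v = 2 * real k - 1 / real W" using k by (simp add: of_nat_diff)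
  have no_summand: False if y: "\<And>i. y i \<le> v i" "weight a y = real k" for y
  proof -
    have "a i dvd y i" for i using dvd_of_integral_weight[OF a cop y(2)] by blast
    then obtain c where c: "\<And>i. y i = a i * c i" unfolding dvd_def by metis
    have zero: "c i = 0" if "i \<noteq> l" for i
    proof -
      have "a i * c i \<le> x i" using y(1)[of i] that by (simp add: c v_def)
      also have "\<dots> < a i" by (rule lt)
      finally show ?thesis by simp
    qed
    have "a l * c l < a l * k"
    proof -
      have "a l * c l \<le> x l + (k - 1) * a l" using y(1)[of l] by (simp add: c v_def)
      also have "\<dots> < a l + (k - 1) * a l" using lt[of l] by simp
      also have "\<dots> = a l * k" using k by (cases k) auto
      finally show ?thesis .
    qed
    then have "c l < k" by simp
    have "weight a y = (\<Sum>i\<in>UNIV. real (c i))"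
      unfolding weight_def using a by (intro sum.cong) (auto simp: c Suc_le_eq)
    also have "\<dots> = real (c l)"
      using zero by (subst sum.remove[of _ l]) (auto intro!: sum.neutral)
    finally show False using y(2) \<open>c l < k\<close> by simp
  qed
  have "2 * k \<ge> 1" using k by simp
  have "weight a v \<le> real (2 * k)" using v W by simp
  then have "nat_vec v \<in> dilate 2 (dilate k (rect_simplex a)) \<inter> int_lattice"
    using nat_vec_in_dilate_iff[of a "2 * k", OF a \<open>2 * k \<ge> 1\<close>] by (simp add: dilate_dilate)
  then obtain y :: "nat \<Rightarrow> real ^ 'n" where y: "\<forall>j<2. y j \<in> dilate k (rect_simplex a) \<inter> int_lattice" "nat_vec v = (\<Sum>j<2. y j)"
    using normal unfolding normal_polytope_def k_def[symmetric] by (meson one_le_numeral)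
  obtain z0 where z0: "y 0 = nat_vec z0" "weight a z0 \<le> real k"
    using int_lattice_dilate_obtain[of a k "y 0", OF a k(1)] y(1) by auto
  obtain z1 where z1: "y 1 = nat_vec z1" "weight a z1 \<le> real k"
    using int_lattice_dilate_obtain[of a k "y 1", OF a k(1)] y(1) by auto
  have "nat_vec v = nat_vec z0 + nat_vec z1" using y(2) z0(1) z1(1) by (simp add: numeral_2_eq_2)
  then have "real (v i) = real (z0 i + z1 i)" for i by (simp add: vec_eq_iff)
  then have sum: "v i = z0 i + z1 i" for i by (simp only: of_nat_eq_iff)
  \<comment> \<open>\<open>A\<close> is the weight in units of 1 / W, hence an integer. The two
    summands have values at most k * W with sum 2 * k * W - 1, so one value is k * W.\<close>
  define A where "A z = (\<Sum>i\<in>UNIV. z i * prod a (UNIV - {i}))" for z :: "'n \<Rightarrow> nat"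
  have A: "real (A z) = weight a z * real W" for z
    unfolding A_def W_def using weight_times_prod[of a z, OF a] by simp
  have le: "A z \<le> k * W" if "weight a z \<le> real k" for z
  proof -
    have "real (A z) \<le> real (k * W)" unfolding A using that by (simp add: mult_right_mono)
    then show ?thesis by (simp only: of_nat_le_iff)
  qed
  have "weight a z0 + weight a z1 = weight a v"
    using weight_add[of a z0 z1] by (simp add: sum[symmetric])
  then have "real (A z0) + real (A z1) = (2 * real k - 1 / real W) * real W"
    unfolding A v[symmetric] by (simp only: distrib_right[symmetric])
  then have "real (A z0 + A z1 + 1) = real (2 * k * W)" using W by (simp add: left_diff_distrib)
  then have "A z0 + A z1 + 1 = 2 * k * W" by (simp only: of_nat_eq_iff)
  with le[OF z0(2)] le[OF z1(2)] consider "A z0 = k * W" | "A z1 = k * W" by linarith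
  then show False
  proof cases
    case 1
    then have "weight a z0 = real k" using A[of z0] W by simp
    then show False using no_summand[of z0] sum by simp
  next
    case 2
    then have "weight a z1 = real k" using A[of z1] W by simp
    then show False using no_summand[of z1] sum by simp
  qed
qed

text \<open>The index asks for normality of all later dilations, so the single failure at n - 2
  rules out every candidate up to n - 2.\<close>

lemma maximally_non_normalI:
  fixes a x :: "'n::finite \<Rightarrow> nat"
  assumes a: "\<And>i. a i \<ge> 1" and n: "CARD('n) \<ge> 3"
    and "\<And>i j. i \<noteq> j \<Longrightarrow> coprime (a i) (a j)" "\<And>i. x i < a i"
    and "weight a x = real (CARD('n) - 1) - 1 / real (prod a UNIV)"
  shows "maximally_non_normal a"
proof -
  have "normality_index (rect_simplex a) = CARD('n) - 1"
    unfolding normality_index_def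
  proof (rule Least_equality)
    show "CARD('n) - 1 \<ge> 1 \<and> (\<forall>k\<ge>CARD('n) - 1. normal_polytope (dilate k (rect_simplex a)))"
      using n by (auto intro!: normal_dilate_rect_simplex[OF a])
  next
    fix k assume k: "k \<ge> 1 \<and> (\<forall>m\<ge>k. normal_polytope (dilate m (rect_simplex a)))"
    show "CARD('n) - 1 \<le> k"
    proof (rule ccontr)
      assume "\<not> CARD('n) - 1 \<le> k"
      then have "k \<le> CARD('n) - 2" by linarith
      with k not_normal_dilate_rect_simplex[OF assms] show False by blast
    qed
  qed
  with a show ?thesis by (simp add: maximally_non_normal_def)
qed

text \<open>Each vertex of one simplex lies in the other, which compares the parameters both ways.
  This lets distinct primes be counted as distinct simplices.\<close>

lemma rect_simplex_inject:
  assumes a: "\<And>i. a i \<ge> 1" and b: "\<And>i. b i \<ge> 1" and eq: "rect_simplex a = rect_simplex b"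
  shows "a = b"
proof
  have le: "a j \<le> b j" if "\<And>i. a i \<ge> 1" "\<And>i. b i \<ge> 1" "rect_simplex a = rect_simplex b" for a b :: "'a \<Rightarrow> nat" and j
  proof -
    have "real (a j) *\<^sub>R axis j 1 \<in> rect_simplex a"
      unfolding rect_simplex_def by (intro hull_inc) auto
    then have "(\<Sum>i\<in>UNIV. (real (a j) *\<^sub>R axis j 1 :: real ^ 'a) $ i / real (b i)) \<le> 1"
      unfolding that(3) mem_rect_simplex[OF that(2)] by blast
    also have "(\<Sum>i\<in>UNIV. (real (a j) *\<^sub>R axis j 1 :: real ^ 'a) $ i / real (b i))
        = (\<Sum>i\<in>UNIV. if i = j then real (a j) / real (b i) else 0)"
      by (intro sum.cong) (auto simp: axis_def)
    also have "\<dots> = real (a j) / real (b j)" by simp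
    finally show ?thesis using that(2)[of j] by (simp add: divide_le_eq)
  qed
  show "a j = b j" for j using le[OF a b eq] le[OF b a eq[symmetric]] by (intro antisym)
qed

section \<open>The residue class of the procedure\<close>

text \<open>Modulo r in P all quotients \<open>\<Prod>P div s\<close> with s different from r
  vanish, so the sum reduces to \<open>\<Prod>P div r\<close>, and q is by construction its inverse
  modulo r. The congruences combine over the pairwise coprime moduli.\<close>

lemma cong_crt_start_mult_sum:
  assumes P: "finite P" "\<forall>r\<in>P. prime r" and q: "[q = crt_start P] (mod \<Prod>P)"
  shows "[q * (\<Sum>r\<in>P. \<Prod>P div r) = 1] (mod \<Prod>P)"
proof -
  have "[q * (\<Sum>r\<in>P. \<Prod>P div r) = 1] (mod r)" if r: "r \<in> P" for r
  proof -
    have r0: "r > 0" using P r prime_gt_0_nat by blast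
    have "[\<Prod>P div s = 0] (mod r)" if s: "s \<in> P - {r}" for s
    proof -
      have "s > 0" using P s prime_gt_0_nat by blast
      have "\<Prod>P = s * \<Prod>(P - {s})" using P s by (intro prod.remove) auto
      then have "\<Prod>P div s = \<Prod>(P - {s})" using \<open>s > 0\<close> by simp
      moreover have "r dvd \<Prod>(P - {s})" using P r s by (intro dvd_Prod) auto
      ultimately show ?thesis by (simp add: cong_0_iff)
    qed
    then have "[(\<Sum>s\<in>P - {r}. \<Prod>P div s) = (\<Sum>s\<in>P - {r}. 0)] (mod r)" by (rule cong_sum)
    then have "[\<Prod>P div r + (\<Sum>s\<in>P - {r}. \<Prod>P div s) = \<Prod>P div r + 0] (mod r)"
      by (intro cong_add) auto
    then have "[(\<Sum>s\<in>P. \<Prod>P div s) = \<Prod>P div r] (mod r)"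
      using P r by (simp add: sum.remove)
    moreover have "[q = inverse_residue P r] (mod r)"
      using cong_dvd_modulus_nat[OF q dvd_Prod[OF P(1) r]] crt_start_works(1)[OF P] r
      by (meson cong_trans)
    ultimately have "[q * (\<Sum>s\<in>P. \<Prod>P div s) = inverse_residue P r * (\<Prod>P div r)] (mod r)"
      by (intro cong_mult)
    also have "[inverse_residue P r * (\<Prod>P div r) = 1] (mod r)"
      using inverse_residue_works(1)[OF P r] by (simp add: mult.commute)
    finally show ?thesis .
  qed
  then have "[q * (\<Sum>r\<in>P. \<Prod>P div r) = 1] (mod (\<Prod>r\<in>P. r))"
    using P by (intro coprime_cong_prod_nat) (auto simp: primes_coprime)
  then show ?thesis by simp
qed

text \<open>With \<open>L = \<Prod>P\<close>, \<open>s = \<Sum>r\<in>P. L / r\<close> and \<open>q * s = 1 + t * L\<close>, the point with coordinates \<open>r - 1\<close>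
  for \<open>r \<in> P\<close> and \<open>t\<close> has weight \<open>(n - 1) - s / L + t / q = (n - 1) - 1 / (q * L)\<close>.\<close>

lemma maximally_non_normal_of_cong:
  fixes p :: "'n::finite \<Rightarrow> nat" and l :: 'n
  assumes n: "CARD('n) \<ge> 3" and bij: "bij_betw p (UNIV - {l}) P"
    and prime: "\<forall>r\<in>P. prime r" and le: "(\<Sum>r\<in>P. 1 / real r) \<le> 1"
    and q: "q > 0" "[q = crt_start P] (mod \<Prod>P)"
  shows "maximally_non_normal (p(l := q))"
proof -
  have fin: "finite P" using bij_betw_finite[OF bij] by simp
  define L where "L = \<Prod>P"
  define s where "s = (\<Sum>r\<in>P. L div r)"
  have L: "L > 0" unfolding L_def using prime by (intro prod_pos) (auto simp: prime_gt_0_nat)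
  have pP: "p i \<in> P" if "i \<noteq> l" for i using bij that by (auto simp: bij_betw_def)
  have p1: "p i \<ge> 1" if "i \<noteq> l" for i
    using prime pP[OF that] prime_gt_0_nat[of "p i"] by (simp add: Suc_le_eq)
  have prodL: "prod p (UNIV - {l}) = L"
    unfolding L_def using prod.reindex_bij_betw[OF bij, of "\<lambda>x. x"] by simp
  have sL: "real s / real L = (\<Sum>r\<in>P. 1 / real r)"
  proof -
    have "real (L div r) / real L = 1 / real r" if "r \<in> P" for r
    proof -
      have "r dvd L" unfolding L_def using fin that by (rule dvd_Prod)
      then show ?thesis using L by (auto simp: real_of_nat_div)
    qed
    then show ?thesis by (simp add: s_def sum_divide_distrib)
  qed
  with le have "real s / real L \<le> 1" by simp
  then have "s \<le> L" using L by (simp add: divide_le_eq_1)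
  have qs: "[q * s = 1] (mod L)"
    unfolding L_def s_def using cong_crt_start_mult_sum[OF fin prime q(2)] .
  \<comment> \<open>Since P is nonempty, s > 0 and q * s \<ge> 1, so the natural-number difference q
    * s - 1 below is not truncated.\<close>
  have "card P = CARD('n) - 1" using bij_betw_same_card[OF bij] by simp
  then have "P \<noteq> {}" using n by auto
  then obtain r where r: "r \<in> P" by blast
  have "r dvd L" unfolding L_def using fin r by (rule dvd_Prod)
  with L have "L div r > 0" by (auto elim!: dvdE)
  then have "s > 0" unfolding s_def using r fin by (intro sum_pos2) auto
  then have "q * s \<ge> 1" using q by simp
  moreover obtain t where "q * s - 1 = L * t" using cong_to_1_nat[OF qs] by (rule dvdE)
  ultimately have t: "q * s = 1 + t * L" by (metis le_add_diff_inverse mult.commute)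
  have "t * L < q * L"
  proof -
    have "t * L < q * s" using t by simp
    also have "\<dots> \<le> q * L" using \<open>s \<le> L\<close> by simp
    finally show ?thesis .
  qed
  then have "t < q" by simp
  have cop_qL: "coprime q L"
    using cong_imp_coprime[OF cong_sym[OF qs]] by simp
  define a where "a = p(l := q)"
  define x where "x = (\<lambda>i. p i - 1)(l := t)"
  have "maximally_non_normal a"
  proof (rule maximally_non_normalI[OF _ n])
    show "a i \<ge> 1" for i using p1 q(1) by (simp add: a_def)
    show "x i < a i" for i using p1[of i] \<open>t < q\<close> by (auto simp: a_def x_def)
    show "coprime (a i) (a j)" if "i \<noteq> j" for i j
    proof -
      have *: "coprime q (p i)" if "i \<noteq> l" for i
        using cop_qL coprime_divisors[OF dvd_refl dvd_Prod[OF fin pP[OF that]]] unfolding L_def by blast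
      have "coprime (p i) (p j)" if "i \<noteq> l" "j \<noteq> l"
      proof -
        have "p i \<noteq> p j" using bij that \<open>i \<noteq> j\<close> by (auto simp: bij_betw_def inj_on_def)
        then show ?thesis using prime pP that by (simp add: primes_coprime)
      qed
      then show ?thesis using * that by (auto simp: a_def coprime_commute)
    qed
    have prodA: "prod a UNIV = q * L"
      using prod.remove[of UNIV l a] prodL by (simp add: a_def)
    have "weight a x = real t / real q + (\<Sum>i\<in>UNIV - {l}. real (x i) / real (a i))"
      unfolding weight_def by (subst sum.remove[of _ l]) (auto simp: a_def x_def)
    also have "(\<Sum>i\<in>UNIV - {l}. real (x i) / real (a i)) = (\<Sum>i\<in>UNIV - {l}. 1 - 1 / real (p i))"
    proof (rule sum.cong)
      fix i assume "i \<in> UNIV - {l}"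
      then have "i \<noteq> l" by simp
      with p1[OF this] show "real (x i) / real (a i) = 1 - 1 / real (p i)"
        by (simp add: a_def x_def of_nat_diff diff_divide_distrib)
    qed simp
    also have "\<dots> = real (CARD('n) - 1) - (\<Sum>i\<in>UNIV - {l}. 1 / real (p i))"
      by (simp add: sum_subtractf)
    also have "(\<Sum>i\<in>UNIV - {l}. 1 / real (p i)) = real s / real L"
      unfolding sL using sum.reindex_bij_betw[OF bij, of "\<lambda>r. 1 / real r"] by simp
    also have "real t / real q + (real (CARD('n) - 1) - real s / real L)
        = real (CARD('n) - 1) - (real (q * s) - real (t * L)) / real (q * L)"
      using L q(1) by (simp add: field_simps)
    also have "real (q * s) - real (t * L) = 1" unfolding t by simp
    finally show "weight a x = real (CARD('n) - 1) - 1 / real (prod a UNIV)"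
      by (simp add: prodA)
  qed
  then show ?thesis by (simp add: a_def)
qed

text \<open>The sum of the quotients is an inverse of the start value modulo
  \<open>\<Prod>P\<close>, so Dirichlet's theorem applies to this class.\<close>

lemma coprime_crt_start:
  assumes "finite P" "\<forall>r\<in>P. prime r"
  shows "coprime (crt_start P) (\<Prod>P)"
  using cong_imp_coprime[OF cong_sym[OF cong_crt_start_mult_sum[OF assms cong_refl]]] by simp

lemma infinite_primes_cong_crt_start:
  assumes "finite P" "\<forall>r\<in>P. prime r"
  shows "infinite {q. prime q \<and> [q = crt_start P] (mod \<Prod>P)}"
  using assms coprime_crt_start[OF assms] by (rule dirichlet_squarefree)

text \<open>The state after k rounds is explicit: the candidate c + k * L and the primes among the
  first k candidates. The loop stops at the least k whose list has at least N entries, and exactly N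
  are present because a round appends at most one.\<close>

lemma simplex_procedure_terminates:
  assumes P: "finite P" "\<forall>r\<in>P. prime r"
  shows "\<exists>ps. simplex_procedure P N = Some ps \<and> length ps = N \<and> distinct ps \<and>
    (\<forall>q\<in>set ps. prime q \<and> [q = crt_start P] (mod \<Prod>P))"
proof -
  define c where "c = crt_start P"
  define L where "L = \<Prod>P"
  define cont where "cont = (\<lambda>(x::nat, ps::nat list). length ps < N)"
  define step where "step = (\<lambda>(x, ps). (x + L, if prime x then ps @ [x] else ps))"
  define found where "found k = filter prime (map (\<lambda>i. c + i * L) [0..<k])" for k
  have L: "L > 0" unfolding L_def using P by (intro prod_pos) (auto simp: prime_gt_0_nat)
  have iter: "(step ^^ k) (c, []) = (c + k * L, found k)" for k
    by (induction k) (auto simp: step_def found_def)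
  have "infinite {i. prime (c + i * L)}"
  proof
    assume "finite {i. prime (c + i * L)}"
    moreover have "{q. prime q \<and> [q = c] (mod L)} \<subseteq> (\<lambda>i. c + i * L) ` {i. prime (c + i * L)}"
    proof
      fix q assume q: "q \<in> {q. prime q \<and> [q = c] (mod L)}"
      \<comment> \<open>As c is the least residue, every prime of the class is at least c and is
        eventually met by the progression.\<close>
      have "c < L" unfolding c_def L_def by (rule crt_start_works(2)[OF P])
      with q have "c = q mod L" by (simp add: cong_def)
      then have "q = c + (q div L) * L" by simp
      with q show "q \<in> (\<lambda>i. c + i * L) ` {i. prime (c + i * L)}"
        by (metis (mono_tags, lifting) image_eqI mem_Collect_eq)
    qed
    ultimately show False
      using infinite_primes_cong_crt_start[OF P] finite_subset unfolding c_def L_def by blast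
  qed
  then obtain I where I: "finite I" "card I = N" "I \<subseteq> {i. prime (c + i * L)}"
    using infinite_arbitrarily_large by blast
  have len: "length (found k) = card {i. i < k \<and> prime (c + i * L)}" for k
    unfolding found_def length_filter_map length_filter_conv_card
    by (intro arg_cong[where f = card]) auto
  obtain K where "\<forall>i\<in>I. i < K" using I(1) finite_nat_set_iff_bounded by blast
  then have "I \<subseteq> {i. i < K \<and> prime (c + i * L)}" using I by auto
  then have "N \<le> length (found K)" unfolding len I(2)[symmetric] by (intro card_mono) auto
  then have ex: "\<exists>k. \<not> cont ((step ^^ k) (c, []))"
    by (auto simp: iter cont_def intro!: exI[of _ K])
  define k where "k = (LEAST k. \<not> cont ((step ^^ k) (c, [])))"
  have "simplex_procedure P N = map_option snd (while_option cont step (c, []))"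
    by (simp add: simplex_procedure_def cont_def step_def c_def L_def)
  also have "while_option cont step (c, []) = Some ((step ^^ k) (c, []))"
    unfolding while_option_def k_def using ex by simp
  also have "map_option snd \<dots> = Some (found k)" by (simp add: iter)
  finally have res: "simplex_procedure P N = Some (found k)" .
  have "\<not> cont ((step ^^ k) (c, []))" unfolding k_def using ex by (rule LeastI_ex)
  then have ge: "length (found k) \<ge> N" by (simp add: iter cont_def)
  moreover have "length (found k) \<le> N"
  proof (cases k)
    case (Suc k')
    then have "k' < k" by simp
    then have "cont ((step ^^ k') (c, []))" unfolding k_def by (metis not_less_Least)
    then have "length (found k') < N" by (simp add: iter cont_def)
    then show ?thesis by (auto simp: Suc found_def)
  qed (simp add: found_def)
  ultimately have "length (found k) = N" by simp
  moreover have "distinct (found k)"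
    unfolding found_def using L by (intro distinct_filter) (simp add: distinct_map inj_on_def)
  moreover have "\<forall>q\<in>set (found k). prime q \<and> [q = c] (mod L)"
    by (auto simp: found_def cong_def)
  ultimately show ?thesis using res unfolding c_def L_def by blast
qed

theorem theorem1p5:
  fixes p :: "'n::finite \<Rightarrow> nat" and l :: 'n and P :: "nat set"
  assumes "CARD('n) \<ge> 3"
    and "bij_betw p (UNIV - {l}) P"
    and "\<forall>q\<in>P. prime q"
    and "(\<Sum>q\<in>P. 1 / real q) \<le> 1"
  shows "infinite {rect_simplex (p(l := q)) | q.
             prime q \<and> q \<notin> P \<and> maximally_non_normal (p(l := q))} \<and>
         (\<forall>N\<ge>1. \<exists>ps. simplex_procedure P N = Some ps \<and> length ps = N \<and>
             distinct (map (\<lambda>q. rect_simplex (p(l := q))) ps) \<and>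
             (\<forall>q\<in>set ps. prime q \<and> q \<notin> P \<and> maximally_non_normal (p(l := q))))"
proof -
  define Q where "Q = {q. prime q \<and> [q = crt_start P] (mod \<Prod>P)}"
  have fin: "finite P" using bij_betw_finite[OF assms(2)] by simp
  have good: "prime q \<and> q \<notin> P \<and> maximally_non_normal (p(l := q))" if "q \<in> Q" for q
  proof -
    have q: "prime q" "[q = crt_start P] (mod \<Prod>P)" using that by (auto simp: Q_def)
    \<comment> \<open>The class is coprime to the modulus, which keeps the primes found outside
      P.\<close>
    have "coprime q (\<Prod>P)"
      using cong_imp_coprime[OF cong_sym[OF q(2)] coprime_crt_start[OF fin assms(3)]] .
    then have "q \<notin> P" using coprime_prod_primes_iff[OF fin assms(3)] by auto
    with q show ?thesis
      using maximally_non_normal_of_cong[OF assms prime_gt_0_nat[OF q(1)] q(2)] by blast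
  qed
  have p1: "(p(l := q)) i \<ge> 1" if "prime q" for q i
  proof (cases "i = l")
    case False
    then have "p i \<in> P" using assms(2) by (auto simp: bij_betw_def)
    with assms(3) False show ?thesis using prime_gt_0_nat[of "p i"] by (simp add: Suc_le_eq)
  qed (use that prime_gt_0_nat[of q] in \<open>simp add: Suc_le_eq\<close>)
  have inj: "inj_on (\<lambda>q. rect_simplex (p(l := q))) {q. prime q}"
  proof (rule inj_onI)
    fix q q' assume "q \<in> {q. prime q}" "q' \<in> {q. prime q}"
      "rect_simplex (p(l := q)) = rect_simplex (p(l := q'))"
    then have "p(l := q) = p(l := q')"
      using p1[of q] p1[of q'] by (intro rect_simplex_inject) auto
    from fun_cong[OF this, of l] show "q = q'" by simp
  qed
  have "infinite ((\<lambda>q. rect_simplex (p(l := q))) ` Q)"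
    using infinite_primes_cong_crt_start[OF fin assms(3)] inj_on_subset[OF inj, of Q]
    by (auto simp: Q_def dest: finite_imageD)
  moreover have "(\<lambda>q. rect_simplex (p(l := q))) ` Q
      \<subseteq> {rect_simplex (p(l := q)) | q. prime q \<and> q \<notin> P \<and> maximally_non_normal (p(l := q))}"
    using good by blast
  ultimately have "infinite {rect_simplex (p(l := q)) | q.
             prime q \<and> q \<notin> P \<and> maximally_non_normal (p(l := q))}"
    using infinite_super by blast
  moreover have "\<exists>ps. simplex_procedure P N = Some ps \<and> length ps = N \<and>
             distinct (map (\<lambda>q. rect_simplex (p(l := q))) ps) \<and>
             (\<forall>q\<in>set ps. prime q \<and> q \<notin> P \<and> maximally_non_normal (p(l := q)))" for N
  proof -
    obtain ps where ps: "simplex_procedure P N = Some ps" "length ps = N" "distinct ps" "set ps \<subseteq> Q"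
      using simplex_procedure_terminates[OF fin assms(3)] unfolding Q_def by blast
    moreover have "distinct (map (\<lambda>q. rect_simplex (p(l := q))) ps)"
      using ps inj by (auto simp: distinct_map Q_def intro: inj_on_subset)
    ultimately show ?thesis using good by blast
  qed
  ultimately show ?thesis by blast
qed

end
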